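(* Let $\Omega_0\subset\mathbb{R}^2$ be a non-empty open convex set that does not contain lines, let $\Omega_1\subset\mathbb{R}^2$ be an open convex set with $\mathrm{cl}\,\Omega_1\subset\Omega_0$, and let $\Omega=\mathrm{cl}(\Omega_0\setminus\Omega_1)$. Assume that neither $\partial\Omega_0$ nor $\partial\Omega_1$ contains linear segments, that $\Omega_0$ is unbounded, and that every ray contained in $\Omega_0$ can be translated so as to belong to $\Omega_1$ entirely. Let $\tilde\Omega$ be an extension of $\Omega$. If $\varphi\in\boldsymbol{A}_\Omega$, then there exists a martingale $M\in\mathcal{M}_{\tilde\Omega}$ such that $M_\infty$ is equimeasurable with $\varphi$.
   Context: For an interval $I$ and a subinterval $J\subset I$, $\langle\varphi\rangle_J=\frac1{|J|}\int_J\varphi(s)\,ds$, and $$\boldsymbol{A}_\Omega=\{\varphi\in L^1(I,\mathbb{R}^2):\ \varphi(I)\subset\partial\Omega_0,\ \langle\varphi\rangle_J\notin\Omega_1\text{ for every subinterval }J\subset I\}.$$ A domain $\tilde\Omega$ is an extension of $\Omega$ if $\tilde\Omega=\mathrm{cl}\,\Omega_0\setminus\tilde\Omega_1$, where $\tilde\Omega_1$ is a convex open set with $\mathrm{cl}\,\tilde\Omega_1\subset\Omega_1$, $\partial\tilde\Omega_1$ contains no linear segments, and every ray contained in $\Omega_0$ can be translated so as to belong to $\tilde\Omega_1$ entirely. The fixed boundary $\partial_{\mathrm{fixed}}w$ of a set $w\subset\mathbb{R}^d$ is the set of $x\in\partial w$ that lie in no open segment $\ell\subset\mathrm{cl}\,w$;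 here $\partial_{\mathrm{fixed}}\Omega=\partial_{\mathrm{fixed}}\tilde\Omega=\partial\Omega_0$. Martingales are discrete-time, over an increasing filtration $\{S_n\}_{n\ge0}$ of finite algebras on the standard probability space $(\mathfrak{S},P)$. For closed $w$, an $\mathbb{R}^d$-valued martingale $M$ adapted to $\{S_n\}$ is a $w$-martingale if: (i) $S_0=\{\emptyset,\mathfrak{S}\}$; (ii) there is a random variable $M_\infty$ with values in $\partial_{\mathrm{fixed}}w$, $\mathbb{E}|M_\infty|<\infty$ and $M_n=\mathbb{E}(M_\infty\mid S_n)$; (iii) for every $n\ge0$ and every atom $\sigma$ of $S_n$, $\mathrm{conv}\big(M_n(\sigma),\{M_{n+1}(z)\}_{z\in\sigma}\big)\subset w$. The set of $w$-martingales is $\mathcal{M}_w$. $M_\infty$ is equimeasurable with $\varphi$ if the distribution of $M_\infty$ equals the image of the normalized Lebesgue measure on $I$ under $\varphi$. *)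

theory Defs
  imports "HOL-Probability.Probability"
begin

section \<open>Planar geometry\<close>

definition ray_from :: "'a::real_vector \<Rightarrow> 'a \<Rightarrow> 'a set" where
  "ray_from p v = {p + t *\<^sub>R v | t. 0 \<le> t}"

definition line_through :: "'a::real_vector \<Rightarrow> 'a \<Rightarrow> 'a set" where
  "line_through p v = range (\<lambda>t. p + t *\<^sub>R v)"

definition contains_line :: "'a::real_vector set \<Rightarrow> bool" where
  "contains_line U \<longleftrightarrow> (\<exists>p v. v \<noteq> 0 \<and> line_through p v \<subseteq> U)"

definition contains_segment :: "'a::real_vector set \<Rightarrow> bool" where
  "contains_segment U \<longleftrightarrow> (\<exists>a b. a \<noteq> b \<and> closed_segment a b \<subseteq> U)"

definition rays_translate_into :: "'a::real_vector set \<Rightarrow> 'a set \<Rightarrow> bool" where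
  "rays_translate_into U V \<longleftrightarrow>
     (\<forall>p v. v \<noteq> 0 \<longrightarrow> ray_from p v \<subseteq> U \<longrightarrow> (\<exists>u. (+) u ` ray_from p v \<subseteq> V))"

text \<open>Here \<open>\<Omega>t\<close> is an extension of the domain \<open>closure (\<Omega>0 - \<Omega>1)\<close>.\<close>

definition is_extension ::
    "'a::euclidean_space set \<Rightarrow> 'a set \<Rightarrow> 'a set \<Rightarrow> bool" where
  "is_extension \<Omega>0 \<Omega>1 \<Omega>t \<longleftrightarrow>
     (\<exists>\<Omega>1t. \<Omega>t = closure \<Omega>0 - \<Omega>1t \<and> convex \<Omega>1t \<and> open \<Omega>1t \<and> closure \<Omega>1t \<subseteq> \<Omega>1 \<and>
        \<not> contains_segment (frontier \<Omega>1t) \<and> rays_translate_into \<Omega>0 \<Omega>1t)"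

definition fixed_boundary :: "'a::euclidean_space set \<Rightarrow> 'a set" where
  "fixed_boundary w =
     {x \<in> frontier w. \<not> (\<exists>a b. a \<noteq> b \<and> x \<in> open_segment a b \<and> open_segment a b \<subseteq> closure w)}"

section \<open>Functions on an interval\<close>

text \<open>Averages are taken over bounded intervals of positive length; the endpoints may or may not
  belong to the interval.\<close>

definition proper_interval :: "real set \<Rightarrow> bool" where
  "proper_interval J \<longleftrightarrow> is_interval J \<and> bounded J \<and> interior J \<noteq> {}"

definition average :: "(real \<Rightarrow> 'a::euclidean_space) \<Rightarrow> real set \<Rightarrow> 'a" where
  "average \<phi> J = (1 / measure lebesgue J) *\<^sub>R (\<integral>s. \<phi> s \<partial>lebesgue_on J)"

text \<open>Elements of \<open>L\<^sup>1\<close> are classes of functions modulo null sets, so the requirement that the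
  values lie in the boundary of \<open>\<Omega>0\<close> is imposed almost everywhere.\<close>

definition class_A ::
    "'a::euclidean_space set \<Rightarrow> 'a set \<Rightarrow> real set \<Rightarrow> (real \<Rightarrow> 'a) set" where
  "class_A \<Omega>0 \<Omega>1 I =
     {\<phi>. integrable (lebesgue_on I) \<phi> \<and>
         (AE s in lebesgue_on I. \<phi> s \<in> frontier \<Omega>0) \<and>
         (\<forall>J. proper_interval J \<longrightarrow> J \<subseteq> I \<longrightarrow> average \<phi> J \<notin> \<Omega>1)}"

definition normalized_lebesgue :: "real set \<Rightarrow> real measure" where
  "normalized_lebesgue I = scale_measure (ennreal (1 / measure lebesgue I)) (lebesgue_on I)"

section \<open>Martingales\<close>

text \<open>The standard probability space is realized as the unit interval with Lebesgue measure.\<close>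

definition std_space :: "real measure" where
  "std_space = lebesgue_on {0..1}"

text \<open>An algebra is represented by a measure, of which only the underlying space and the measurable
  sets are relevant (as in \<^const>\<open>subalgebra\<close>); a finite algebra is automatically a
  \<open>\<sigma>\<close>-algebra.\<close>

definition finite_filtration :: "'s measure \<Rightarrow> (nat \<Rightarrow> 's measure) \<Rightarrow> bool" where
  "finite_filtration P S \<longleftrightarrow>
     filtration (space P) S \<and> (\<forall>n. subalgebra P (S n) \<and> finite (sets (S n)))"

definition atoms :: "'s measure \<Rightarrow> 's set set" where
  "atoms F = {\<sigma> \<in> sets F. \<sigma> \<noteq> {} \<and> (\<forall>\<tau>\<in>sets F. \<tau> \<subseteq> \<sigma> \<longrightarrow> \<tau> = {} \<or> \<tau> = \<sigma>)}"

text \<open>\<open>Y\<close> is a version of the conditional expectation of the vector-valued \<open>X\<close> given \<open>F\<close>; the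
  conditional expectation is taken coordinatewise.\<close>

definition is_cond_exp ::
    "'s measure \<Rightarrow> 's measure \<Rightarrow> ('s \<Rightarrow> 'a::euclidean_space) \<Rightarrow> ('s \<Rightarrow> 'a) \<Rightarrow> bool" where
  "is_cond_exp P F X Y \<longleftrightarrow>
     integrable P X \<and> Y \<in> borel_measurable F \<and>
     (\<forall>b\<in>Basis. AE s in P. Y s \<bullet> b = real_cond_exp P F (\<lambda>z. X z \<bullet> b) s)"

definition martingale ::
    "'s measure \<Rightarrow> (nat \<Rightarrow> 's measure) \<Rightarrow> (nat \<Rightarrow> 's \<Rightarrow> 'a::euclidean_space) \<Rightarrow> bool" where
  "martingale P S M \<longleftrightarrow>
     (\<forall>n. M n \<in> borel_measurable (S n) \<and> integrable P (M n) \<and> is_cond_exp P (S n) (M (Suc n)) (M n))"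

definition closed_by ::
    "'s measure \<Rightarrow> 'a::euclidean_space set \<Rightarrow> (nat \<Rightarrow> 's measure) \<Rightarrow> (nat \<Rightarrow> 's \<Rightarrow> 'a) \<Rightarrow>
      ('s \<Rightarrow> 'a) \<Rightarrow> bool" where
  "closed_by P w S M X \<longleftrightarrow>
     X \<in> borel_measurable P \<and> (\<forall>s\<in>space P. X s \<in> fixed_boundary w) \<and> integrable P X \<and>
     (\<forall>n. is_cond_exp P (S n) X (M n))"

text \<open>A function measurable with respect to \<open>S n\<close> is constant on the atoms of \<open>S n\<close>, so
  \<open>M n ` \<sigma>\<close> below is a singleton.\<close>

definition w_martingale ::
    "'s measure \<Rightarrow> 'a::euclidean_space set \<Rightarrow> (nat \<Rightarrow> 's measure) \<Rightarrow> (nat \<Rightarrow> 's \<Rightarrow> 'a) \<Rightarrow> bool" where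
  "w_martingale P w S M \<longleftrightarrow>
     finite_filtration P S \<and> martingale P S M \<and>
     sets (S 0) = {{}, space P} \<and>
     (\<exists>X. closed_by P w S M X) \<and>
     (\<forall>n. \<forall>\<sigma>\<in>atoms (S n). convex hull (M n ` \<sigma> \<union> M (Suc n) ` \<sigma>) \<subseteq> w)"

text \<open>The random variable \<open>M\<^sub>\<infinity>\<close> attached to \<open>M\<close>: it closes \<open>M\<close> and is the almost sure limit of
  \<open>M\<close>. Being a closing variable alone does not determine \<open>X\<close> (a constant martingale is closed
  by every variable with the right mean), so the limit is part of the definition.\<close>

definition terminal_value ::
    "'s measure \<Rightarrow> 'a::euclidean_space set \<Rightarrow> (nat \<Rightarrow> 's measure) \<Rightarrow> (nat \<Rightarrow> 's \<Rightarrow> 'a) \<Rightarrow>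
      ('s \<Rightarrow> 'a) \<Rightarrow> bool" where
  "terminal_value P w S M X \<longleftrightarrow>
     closed_by P w S M X \<and> (AE s in P. (\<lambda>n. M n s) \<longlonglongrightarrow> X s)"

definition equimeasurable ::
    "'s measure \<Rightarrow> ('s \<Rightarrow> 'a::euclidean_space) \<Rightarrow> real set \<Rightarrow> (real \<Rightarrow> 'a) \<Rightarrow> bool" where
  "equimeasurable P X I \<phi> \<longleftrightarrow> distr P borel X = distr (normalized_lebesgue I) borel \<phi>"

lemma prob_space_std_space: "prob_space std_space"
  by (rule prob_spaceI) (simp add: std_space_def space_restrict_space emeasure_restrict_space)

lemma prob_space_normalized_lebesgue:
  assumes "proper_interval I"
  shows "prob_space (normalized_lebesgue I)"
proof -
  have lm: "I \<in> lmeasurable"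
    using assms unfolding proper_interval_def by (simp add: is_interval_convex measurable_convex)
  obtain x e where e: "e > 0" "ball x e \<subseteq> I"
    using assms unfolding proper_interval_def by (meson ex_in_conv mem_interior)
  have "0 < measure lebesgue (ball x e)"
    using e(1) by (simp add: content_ball_pos)
  also have "\<dots> \<le> measure lebesgue I"
    by (intro measure_mono_fmeasurable e(2) lm) auto
  finally have pos: "0 < measure lebesgue I" .
  have "emeasure (lebesgue_on I) I = ennreal (measure lebesgue I)"
    using lm by (simp add: emeasure_restrict_space emeasure_eq_measure2 fmeasurableD)
  then show ?thesis
    using pos by (intro prob_spaceI)
      (simp add: normalized_lebesgue_def space_scale_measure space_restrict_space
        flip: ennreal_mult)
qed

end

theory Submission
  imports Defs
begin

text \<open>
  After an affine change of variable, \<open>\<phi>\<close> lives on the unit interval, and \<open>M\<^sub>n\<close> is the average of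
  \<open>\<phi>\<close> over the cell of the \<open>n\<close>-th of a sequence of nested partitions. Let \<open>W\<close> be the removed set of
  the extension. A cell is cut at its midpoint if the segment joining the two averages misses \<open>W\<close>;
  otherwise the cut moves from the midpoint towards the endpoint until, for the last time, the segment
  from the average \<open>x\<close> of the cell to the average of the larger part misses \<open>W\<close>. That segment then
  touches the closure of \<open>W\<close>, hence its line supports \<open>W\<close>, and the whole segment between the
  two averages misses \<open>W\<close>.

  The cells around a point shrink to it: otherwise they decrease to a nondegenerate interval \<open>J\<close>,
  from some step on all cuts are of the second kind with the larger part retained, and the touching points
  converge to the average over \<open>J\<close>, which lies outside \<open>\<Omega>\<^sub>1 \<supseteq> closure W\<close>. By Henstock's lemma
  the averages over shrinking nested cells converge almost everywhere to \<open>\<phi>\<close>.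
\<close>

section \<open>Splitting an interval\<close>

text \<open>If \<open>F\<close> is an indefinite integral of \<open>f\<close>, this chord slope is
  the mean of \<open>f\<close> over \<open>{a..b}\<close>; cuts can then be found from the
  continuity of \<open>F\<close>.\<close>

definition slope :: "(real \<Rightarrow> 'a::real_normed_vector) \<Rightarrow> real \<Rightarrow> real \<Rightarrow> 'a" where
  "slope F a b = (1 / (b - a)) *\<^sub>R (F b - F a)"

lemma slope_in_closed_segment:
  assumes "a < t" "t < b"
  shows "slope F a b \<in> closed_segment (slope F a t) (slope F t b)"
proof -
  define u where "u = (b - t) / (b - a)"
  have u: "0 \<le> u" "u \<le> 1" using assms by (auto simp: u_def field_simps)
  have "u * (1 / (b - t)) = 1 / (b - a)" "(1 - u) * (1 / (t - a)) = 1 / (b - a)"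
    using assms by (auto simp: u_def field_simps)
  then have "(1 - u) *\<^sub>R slope F a t + u *\<^sub>R slope F t b
      = (1 / (b - a)) *\<^sub>R (F t - F a) + (1 / (b - a)) *\<^sub>R (F b - F t)"
    by (simp add: slope_def)
  also have "\<dots> = slope F a b"
    by (simp add: slope_def algebra_simps)
  finally show ?thesis using u unfolding closed_segment_def by (intro CollectI exI[of _ u]) simp
qed

text \<open>A point \<open>q\<close> of \<open>W\<close> on the long segment would lie between
  \<open>z\<close> and \<open>x\<close>, since the rest misses \<open>W\<close>. Then
  \<open>x\<close> would lie strictly between \<open>q\<close> and a touching point of
  \<open>closure W\<close> on the side of \<open>y\<close>, hence in the open convex set
  \<open>W\<close>.\<close>

lemma segment_beyond_misses:
  fixes W :: "'a::euclidean_space set"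
  assumes W: "open W" "convex W" and x: "x \<in> closed_segment z y"
    and out: "x \<notin> closure W" "y \<notin> closure W"
    and miss: "closed_segment x y \<inter> W = {}" and touch: "closed_segment x y \<inter> closure W \<noteq> {}"
  shows "closed_segment z y \<inter> W = {}"
proof (rule ccontr)
  assume "closed_segment z y \<inter> W \<noteq> {}"
  then obtain q where q: "q \<in> closed_segment z y" "q \<in> W" by blast
  obtain p where p: "p \<in> closed_segment x y" "p \<in> closure W" using touch by blast
  have "q \<in> closed_segment z x"
    using q miss Un_closed_segment[OF x] by blast
  have "between (z, x) q" "between (x, y) p" "between (z, y) x"
    using \<open>q \<in> closed_segment z x\<close> p x by (auto simp: between_mem_segment)
  then have "between (q, p) x"
    by (metis between_commute between_trans_2)
  moreover have "x \<noteq> q" "x \<noteq> p" using out q p closure_subset[of W] by auto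
  ultimately have "x \<in> open_segment q p"
    by (auto simp: between_mem_segment open_segment_def)
  then have "x \<in> interior W"
    using in_interior_closure_convex_segment[OF W(2), of q p] q p W(1) by (auto simp: interior_open)
  then show False using out interior_subset closure_subset by blast
qed

text \<open>The cut is the largest \<open>t\<close> in \<open>{a..c}\<close> for which the segment
  from the mean of the whole to the mean of the right part misses \<open>W\<close>. At
  \<open>t = a\<close> this segment is a point outside \<open>W\<close>, at \<open>t = c\<close> it
  meets \<open>W\<close>. Just beyond the largest \<open>t\<close> it meets \<open>W\<close>, so at
  \<open>t\<close> it touches \<open>closure W\<close>.\<close>

lemma split_point_left:
  fixes F :: "real \<Rightarrow> 'a::euclidean_space"
  assumes F: "continuous_on {a..b} F" and ab: "a < c" "c < b" and W: "open W" "convex W"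
    and avoid: "\<And>x y. a \<le> x \<Longrightarrow> x < y \<Longrightarrow> y \<le> b \<Longrightarrow> slope F x y \<notin> closure W"
    and hit: "closed_segment (slope F a b) (slope F c b) \<inter> W \<noteq> {}"
  obtains t where "a < t" "t < c" "closed_segment (slope F a t) (slope F t b) \<inter> W = {}"
    "closed_segment (slope F a b) (slope F t b) \<inter> closure W \<noteq> {}"
proof -
  define x where "x = slope F a b"
  define g where "g t u = (1 - u) *\<^sub>R x + u *\<^sub>R slope F t b" for t u :: real
  define T where "T = {t \<in> {a..c}. closed_segment x (slope F t b) \<inter> W = {}}"
  define K where "K = {t \<in> {a..c}. closed_segment x (slope F t b) \<inter> closure W \<noteq> {}}"
  have x: "x \<notin> closure W" "x \<notin> W"
    using avoid[of a b] ab closure_subset[of W] by (auto simp: x_def)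
  have Fc: "continuous_on {a..c} F"
    using F ab continuous_on_subset by fastforce
  have slc: "continuous_on {a..c} (\<lambda>t. slope F t b)"
    unfolding slope_def using ab by (intro continuous_intros Fc) auto
  have seg: "closed_segment x (slope F t b) = g t ` {0..1}" for t
    by (auto simp: closed_segment_def g_def)
  have gc: "continuous_on {a..c} (\<lambda>t. g t u)" for u
    unfolding g_def by (intro continuous_intros slc)
  have "closed T"
  proof -
    \<comment> \<open>As \<open>W\<close> is open, avoiding it is a closed condition on
      \<open>t\<close> for each segment parameter \<open>u\<close>. The index set has to be nonempty
      for the intersection to stay inside \<open>{a..c}\<close>.\<close>
    have "(0::real) \<in> {0..1}" by simp
    then have "T = (\<Inter>u\<in>{0..1}. {t \<in> {a..c}. g t u \<in> - W})"
      unfolding T_def seg by blast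
    moreover have "closed {t \<in> {a..c}. g t u \<in> - W}" for u
      using continuous_closed_preimage[OF gc closed_real_atLeastAtMost, of "- W" u] W(1)
      by (simp add: closed_Compl vimage_def Int_def)
    ultimately show ?thesis by (simp add: closed_INT)
  qed
  moreover have "T \<subseteq> {a..c}" by (auto simp: T_def)
  ultimately have Tc: "compact T"
    using compact_Icc compact_Int_closed[of "{a..c}" T] by (simp add: Int_absorb1)
  have "a \<in> T" using x ab by (auto simp: T_def x_def)
  obtain t where t: "t \<in> T" "\<And>s. s \<in> T \<Longrightarrow> s \<le> t"
    using compact_attains_sup[OF Tc] \<open>a \<in> T\<close> by blast
  have "c \<notin> T" using hit by (simp add: T_def x_def)
  then have tc: "t < c" "a \<le> t" using t by (auto simp: T_def less_le)
  have "closed K"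
  proof -
    \<comment> \<open>\<open>K\<close> is the projection of a compact set of pairs (cut, segment
      parameter) to the first coordinate.\<close>
    have "continuous_on ({a..c} \<times> {0..1}) (\<lambda>z. g (fst z) (snd z))"
      unfolding g_def
      by (intro continuous_intros continuous_on_compose2[OF slc]) auto
    then have "closed ({a..c} \<times> {0..1} \<inter> (\<lambda>z. g (fst z) (snd z)) -` closure W)"
      by (intro continuous_closed_preimage closed_Times) auto
    then have "compact (({a..c} \<times> {0..1}) \<inter> ({a..c} \<times> {0..1} \<inter> (\<lambda>z. g (fst z) (snd z)) -` closure W))"
      by (intro compact_Int_closed compact_Times compact_Icc)
    moreover have "({a..c} \<times> {0..1}) \<inter> ({a..c} \<times> {0..1} \<inter> (\<lambda>z. g (fst z) (snd z)) -` closure W)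
        = {z \<in> {a..c} \<times> {0..1}. g (fst z) (snd z) \<in> closure W}"
      by auto
    ultimately have "compact {z \<in> {a..c} \<times> {0..1}. g (fst z) (snd z) \<in> closure W}"
      by simp
    then have "compact (fst ` {z \<in> {a..c} \<times> {0..1}. g (fst z) (snd z) \<in> closure W})"
      by (intro compact_continuous_image continuous_intros)
    moreover have "fst ` {z \<in> {a..c} \<times> {0..1}. g (fst z) (snd z) \<in> closure W} = K"
      unfolding K_def seg by force
    ultimately show ?thesis by (simp add: compact_imp_closed)
  qed
  \<comment> \<open>Maximality of \<open>t\<close> puts every cut between \<open>t\<close> and
    \<open>c\<close> into \<open>K\<close>, and closedness carries this over to
    \<open>t\<close>.\<close>
  have "{t<..<c} \<subseteq> K"
  proof
    fix s assume s: "s \<in> {t<..<c}"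
    then have "s \<notin> T" using t(2)[of s] by auto
    then show "s \<in> K" using s tc closure_subset[of W] by (auto simp: K_def T_def)
  qed
  then have "closure {t<..<c} \<subseteq> K" using \<open>closed K\<close> by (simp add: closure_minimal)
  then have "t \<in> K" using tc by auto
  then have touch: "closed_segment x (slope F t b) \<inter> closure W \<noteq> {}" by (simp add: K_def)
  \<comment> \<open>At \<open>t = a\<close> the segment is the single point \<open>x\<close>, which
    is outside \<open>closure W\<close>.\<close>
  then have "t \<noteq> a" using x by (auto simp: x_def)
  then have "a < t" using tc by auto
  have "closed_segment (slope F a t) (slope F t b) \<inter> W = {}"
  proof (rule segment_beyond_misses[OF W])
    show "x \<in> closed_segment (slope F a t) (slope F t b)"
      unfolding x_def by (rule slope_in_closed_segment) (use \<open>a < t\<close> tc ab in auto)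
    show "slope F t b \<notin> closure W" using tc ab by (intro avoid) auto
    show "closed_segment x (slope F t b) \<inter> W = {}" using t(1) by (simp add: T_def)
  qed (use x touch in auto)
  then show thesis using that \<open>a < t\<close> tc touch by (simp add: x_def)
qed

text \<open>The last two conclusions are what makes repeated cutting shrink the cells: a part longer
  than half of the interval is possible only if the segment from the old mean to the mean of that
  part touches \<open>closure W\<close>.\<close>

lemma split_point:
  fixes F :: "real \<Rightarrow> 'a::euclidean_space"
  assumes F: "continuous_on {a..b} F" and ab: "a < b" and W: "open W" "convex W"
    and avoid: "\<And>x y. a \<le> x \<Longrightarrow> x < y \<Longrightarrow> y \<le> b \<Longrightarrow> slope F x y \<notin> closure W"
  obtains t where "a < t" "t < b" "closed_segment (slope F a t) (slope F t b) \<inter> W = {}"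
    "t - a \<le> (b - a) / 2 \<or> closed_segment (slope F a b) (slope F a t) \<inter> closure W \<noteq> {}"
    "b - t \<le> (b - a) / 2 \<or> closed_segment (slope F a b) (slope F t b) \<inter> closure W \<noteq> {}"
proof -
  define c where "c = (a + b) / 2"
  have c: "a < c" "c < b" "c - a = (b - a) / 2" "b - c = (b - a) / 2"
    using ab by (auto simp: c_def field_simps)
  \<comment> \<open>The mean of the whole divides the segment between the means of the two halves,
    so if that segment meets \<open>W\<close>, one of its two pieces does.\<close>
  consider "closed_segment (slope F a c) (slope F c b) \<inter> W = {}"
    | "closed_segment (slope F a b) (slope F c b) \<inter> W \<noteq> {}"
    | "closed_segment (slope F a b) (slope F a c) \<inter> W \<noteq> {}"
    using Un_closed_segment[OF slope_in_closed_segment[OF c(1,2), of F]]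
    by (metis Int_Un_distrib2 Un_empty closed_segment_commute)
  then show thesis
  proof cases
    case 1
    then show thesis using that[of c] c by simp
  next
    case 2
    obtain t where "a < t" "t < c" "closed_segment (slope F a t) (slope F t b) \<inter> W = {}"
      "closed_segment (slope F a b) (slope F t b) \<inter> closure W \<noteq> {}"
      using split_point_left[OF F c(1,2) W avoid 2] by blast
    then show thesis using that[of t] c by linarith
  next
    case 3
    \<comment> \<open>Reflection at the midpoint exchanges left and right; with the sign, slopes of
      \<open>G\<close> are slopes of \<open>F\<close> over the reflected intervals.\<close>
    define G where "G s = - F (a + b - s)" for s
    have G: "slope G x y = slope F (a + b - y) (a + b - x)" for x y
      by (simp add: slope_def G_def algebra_simps)
    have "continuous_on {a..b} G"
      unfolding G_def by (intro continuous_intros continuous_on_compose2[OF F]) auto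
    moreover have "slope G x y \<notin> closure W" if "a \<le> x" "x < y" "y \<le> b" for x y
      unfolding G using that by (intro avoid) auto
    moreover have "slope G a b = slope F a b" "slope G c b = slope F a c"
      by (simp_all add: G c_def field_simps)
    then have "closed_segment (slope G a b) (slope G c b) \<inter> W \<noteq> {}"
      using 3 by simp
    ultimately obtain t where t: "a < t" "t < c" "closed_segment (slope G a t) (slope G t b) \<inter> W = {}"
      "closed_segment (slope G a b) (slope G t b) \<inter> closure W \<noteq> {}"
      using split_point_left[OF _ c(1,2) W, of G] by blast
    then show thesis using that[of "a + b - t"] c
      by (simp add: G closed_segment_commute)
  qed
qed

section \<open>Nested partitions\<close>

locale bisection =
  fixes sp :: "real \<Rightarrow> real \<Rightarrow> real"
  assumes sp: "\<And>a b. 0 \<le> a \<Longrightarrow> a < b \<Longrightarrow> b \<le> 1 \<Longrightarrow> a < sp a b \<and> sp a b < b"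
begin

text \<open>The pair of endpoints serves as a label of the cell of \<open>s\<close>. A cut point
  goes to the cell on its right, so within the unit interval cells are half-open, except that the
  last one contains 1.\<close>

primrec cell :: "nat \<Rightarrow> real \<Rightarrow> real \<times> real" where
  "cell 0 s = (0, 1)"
| "cell (Suc n) s =
    (let (a, b) = cell n s; t = sp a b in if s < t then (a, t) else (t, b))"

definition lo :: "nat \<Rightarrow> real \<Rightarrow> real" where "lo n s = fst (cell n s)"
definition hi :: "nat \<Rightarrow> real \<Rightarrow> real" where "hi n s = snd (cell n s)"

lemma cell_eq: "cell n s = (lo n s, hi n s)"
  by (simp add: lo_def hi_def)

lemma lo_hi_0 [simp]: "lo 0 s = 0" "hi 0 s = 1"
  by (simp_all add: lo_def hi_def)

lemma lo_Suc: "lo (Suc n) s = (if s < sp (lo n s) (hi n s) then lo n s else sp (lo n s) (hi n s))"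
  and hi_Suc: "hi (Suc n) s = (if s < sp (lo n s) (hi n s) then sp (lo n s) (hi n s) else hi n s)"
  by (simp_all add: lo_def hi_def Let_def split: prod.splits)

lemma cell_bounds:
  assumes "s \<in> {0..1}"
  shows "0 \<le> lo n s" "lo n s < hi n s" "hi n s \<le> 1" "lo n s \<le> s" "s \<le> hi n s"
proof -
  have "0 \<le> lo n s \<and> lo n s < hi n s \<and> hi n s \<le> 1 \<and> lo n s \<le> s \<and> s \<le> hi n s"
  proof (induction n)
    case (Suc n)
    then show ?case using sp[of "lo n s" "hi n s"] by (auto simp: lo_Suc hi_Suc)
  qed (use assms in auto)
  then show "0 \<le> lo n s" "lo n s < hi n s" "hi n s \<le> 1" "lo n s \<le> s" "s \<le> hi n s"
    by auto
qed

lemma cell_eqI: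
  assumes "s \<in> {0..1}" "lo n s \<le> u" "u < hi n s"
  shows "cell n u = cell n s"
  using assms(2,3)
proof (induction n)
  case (Suc n)
  have "lo n s \<le> u \<and> u < hi n s"
    using Suc.prems sp[of "lo n s" "hi n s"] cell_bounds[OF assms(1), of n]
    by (auto simp: lo_Suc hi_Suc split: if_splits)
  then have eq: "cell n u = cell n s" using Suc.IH by blast
  then have "lo n u = lo n s" "hi n u = hi n s" by (simp_all add: lo_def hi_def)
  moreover have "u < sp (lo n s) (hi n s) \<longleftrightarrow> s < sp (lo n s) (hi n s)"
    using Suc.prems by (auto simp: lo_Suc hi_Suc split: if_splits)
  ultimately show ?case by (simp only: cell_eq[of "Suc n"] lo_Suc hi_Suc)
qed simp

text \<open>A cell contains its left endpoint, so the left endpoint of the finer cell lies in the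
  coarser cell and determines its label.\<close>

lemma cell_refine:
  assumes "s \<in> {0..1}" "u \<in> {0..1}" "cell (Suc n) s = cell (Suc n) u"
  shows "cell n s = cell n u"
proof -
  have *: "cell n (lo (Suc n) v) = cell n v" if "v \<in> {0..1}" for v
    using that sp[of "lo n v" "hi n v"] cell_bounds[OF that, of n]
    by (intro cell_eqI) (auto simp: lo_Suc)
  have "lo (Suc n) s = lo (Suc n) u" using assms(3) by (simp add: lo_def)
  then show ?thesis using *[OF assms(1)] *[OF assms(2)] by simp
qed

lemma cell_refine_le:
  assumes "n \<le> m" "s \<in> {0..1}" "u \<in> {0..1}" "cell m s = cell m u"
  shows "cell n s = cell n u"
  using assms(1,4)
proof (induction m rule: dec_induct)
  case (step m)
  then show ?case using cell_refine[OF assms(2,3)] by blast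
qed

lemma finite_cells: "finite (cell n ` A)"
proof (induction n)
  case 0
  have "cell 0 ` A \<subseteq> {(0, 1)}" by auto
  then show ?case by (rule finite_subset) simp
next
  case (Suc n)
  \<comment> \<open>A label of the next step is a function of the present label and one bit, the
    side of the cut.\<close>
  define g where "g = (\<lambda>(p, c). let t = sp (fst p) (snd p) in if c then (fst p, t) else (t, snd p))"
  have "cell (Suc n) s = g (cell n s, s < sp (lo n s) (hi n s))" for s
    by (simp add: g_def Let_def lo_def hi_def split_beta)
  then have "cell (Suc n) ` A \<subseteq> g ` (cell n ` A \<times> UNIV)"
    by blast
  moreover have "finite (g ` (cell n ` A \<times> UNIV))"
    using Suc.IH by (intro finite_imageI[of _ g] finite_cartesian_product) auto
  ultimately show ?case by (rule finite_subset)
qed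

section \<open>The finite algebras generated by the cells\<close>

definition block :: "nat \<Rightarrow> real \<Rightarrow> real set" where
  "block n s = {u \<in> {0..1}. cell n u = cell n s}"

lemma block_bounds:
  assumes "s \<in> {0..1}"
  shows "{lo n s..<hi n s} \<subseteq> block n s" "block n s \<subseteq> {lo n s..hi n s}"
proof -
  show "{lo n s..<hi n s} \<subseteq> block n s"
    using cell_eqI[OF assms, of n] cell_bounds[OF assms, of n] by (auto simp: block_def)
  show "block n s \<subseteq> {lo n s..hi n s}"
  proof
    fix u assume u: "u \<in> block n s"
    then have "lo n u = lo n s" "hi n u = hi n s" by (simp_all add: block_def lo_def hi_def)
    then show "u \<in> {lo n s..hi n s}" using cell_bounds[of u n] u by (auto simp: block_def)
  qed
qed

lemma block_cases:
  assumes "s \<in> {0..1}"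
  shows "block n s = {lo n s..<hi n s} \<or> block n s = {lo n s..hi n s}"
  using block_bounds[OF assms, of n] by (force simp: set_eq_iff less_le)

lemma block_lmeasurable: "s \<in> {0..1} \<Longrightarrow> block n s \<in> lmeasurable"
  using block_cases[of s n] by (auto intro!: measurable_convex)

definition part :: "nat \<Rightarrow> real measure" where
  "part n = vimage_algebra {0..1} (cell n) (count_space UNIV)"

lemma space_part [simp]: "space (part n) = {0..1}"
  by (simp add: part_def)

lemma sets_part: "sets (part n) = {cell n -` B \<inter> {0..1} | B. True}"
  by (auto simp: part_def sets_vimage_algebra2)

text \<open>\<open>Q\<close> contains one representative for each of the finitely many labels
  occurring in \<open>A\<close>; distinct labels make the blocks disjoint.\<close>

lemma part_setsE:
  assumes "A \<in> sets (part n)"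
  obtains Q where "finite Q" "Q \<subseteq> {0..1}" "A = (\<Union>s\<in>Q. block n s)"
    "disjoint_family_on (block n) Q"
proof -
  obtain B where B: "A = cell n -` B \<inter> {0..1}" using assms by (auto simp: sets_part)
  obtain Q where Q: "Q \<subseteq> A" "finite Q" "cell n ` A = cell n ` Q" "inj_on (cell n) Q"
  proof -
    obtain Q where "Q \<subseteq> A" "inj_on (cell n) Q" "cell n ` A = cell n ` Q"
      using subset_image_inj[of "cell n ` A" "cell n" A] by auto
    then show thesis using that[of Q] finite_cells[of n A] finite_image_iff[of "cell n" Q] by simp
  qed
  have eq: "A = (\<Union>s\<in>Q. block n s)"
  proof
    show "A \<subseteq> (\<Union>s\<in>Q. block n s)"
    proof
      fix x assume x: "x \<in> A"
      then obtain s where "s \<in> Q" "cell n x = cell n s" using Q(3) by blast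
      then show "x \<in> (\<Union>s\<in>Q. block n s)" using x B by (auto simp: block_def)
    qed
    show "(\<Union>s\<in>Q. block n s) \<subseteq> A"
      using Q(1) B by (auto simp: block_def)
  qed
  have disj: "disjoint_family_on (block n) Q"
    using Q(4) by (auto simp: disjoint_family_on_def block_def inj_on_def)
  have "Q \<subseteq> {0..1}" using Q(1) B by blast
  then show thesis by (rule that[OF Q(2) _ eq disj])
qed

lemma measurable_cell: "(\<lambda>s. h (cell n s)) \<in> measurable (part n) N" if "\<And>c. h c \<in> space N"
proof (rule measurableI)
  fix A assume "A \<in> sets N"
  have "(\<lambda>s. h (cell n s)) -` A \<inter> space (part n) = cell n -` (h -` A) \<inter> {0..1}" by auto
  then show "(\<lambda>s. h (cell n s)) -` A \<inter> space (part n) \<in> sets (part n)"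
    unfolding sets_part by blast
qed (use that in auto)

lemma sets_part_lebesgue: "A \<in> sets (part n) \<Longrightarrow> A \<in> sets (lebesgue_on {0..1})"
proof -
  assume "A \<in> sets (part n)"
  then obtain Q where Q: "finite Q" "Q \<subseteq> {0..1}" "A = (\<Union>s\<in>Q. block n s)"
    using part_setsE by metis
  have "A \<in> sets lebesgue"
    unfolding Q(3) using Q block_lmeasurable by (intro sets.finite_UN) (auto simp: fmeasurableD)
  moreover have "A \<subseteq> {0..1}" using Q by (auto simp: block_def)
  ultimately show ?thesis by (simp add: sets_restrict_space_iff)
qed

lemma finite_filtration_part: "finite_filtration std_space part"
proof -
  have mono: "sets (part n) \<subseteq> sets (part m)" if "n \<le> m" for n m
  proof
    fix A assume "A \<in> sets (part n)"
    then obtain B where A: "A = cell n -` B \<inter> {0..1}" by (auto simp: sets_part)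
    \<comment> \<open>\<open>A\<close> is a union of fibres of the finer labelling, hence the
      preimage of its own finer labels.\<close>
    have "x \<in> A" if "x \<in> {0..1}" "y \<in> A" "cell m x = cell m y" for x y
      using cell_refine_le[OF \<open>n \<le> m\<close>, of x y] that A by auto
    then have "A = cell m -` (cell m ` A) \<inter> {0..1}"
      using A by blast
    then show "A \<in> sets (part m)" unfolding sets_part by blast
  qed
  have "finite (sets (part n))" for n
  proof -
    have "sets (part n) \<subseteq> (\<lambda>B. cell n -` B \<inter> {0..1}) ` Pow (cell n ` {0..1})"
    proof
      fix A assume "A \<in> sets (part n)"
      then obtain B where "A = cell n -` B \<inter> {0..1}" by (auto simp: sets_part)
      then have "A = cell n -` (B \<inter> cell n ` {0..1}) \<inter> {0..1}" by auto
      then show "A \<in> (\<lambda>B. cell n -` B \<inter> {0..1}) ` Pow (cell n ` {0..1})" by blast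
    qed
    then show ?thesis using finite_cells by (meson finite_Pow_iff finite_imageI finite_subset)
  qed
  moreover have "filtration (space std_space) part"
    using mono by unfold_locales (simp_all add: std_space_def)
  moreover have "subalgebra std_space (part n)" for n
    using sets_part_lebesgue[of _ n] by (auto simp: subalgebra_def std_space_def)
  ultimately show ?thesis
    by (simp add: finite_filtration_def)
qed

lemma sets_part_0: "sets (part 0) = {{}, space std_space}"
proof -
  have "cell 0 -` B \<inter> {0..1} \<in> {{}, {0..1}}" for B
    by (cases "(0, 1) \<in> B") auto
  moreover have "cell 0 -` {} \<inter> {0..1} = {}" "cell 0 -` UNIV \<inter> {0..1} = {0..1}" by auto
  ultimately have "sets (part 0) = {{}, {0..1}}"
    unfolding sets_part by blast
  then show ?thesis by (simp add: std_space_def)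
qed

text \<open>The block of a point of an atom is itself a set of the algebra inside the atom, so
  minimality makes the two equal.\<close>

lemma atom_part_cell_eq:
  assumes "\<sigma> \<in> atoms (part n)" "s \<in> \<sigma>" "u \<in> \<sigma>"
  shows "s \<in> {0..1}" "cell n u = cell n s"
proof -
  obtain B where B: "\<sigma> = cell n -` B \<inter> {0..1}" using assms(1) by (auto simp: atoms_def sets_part)
  then show "s \<in> {0..1}" using assms by auto
  have "block n s \<in> sets (part n)"
    unfolding sets_part by (intro CollectI exI[of _ "{cell n s}"]) (auto simp: block_def)
  moreover have "block n s \<subseteq> \<sigma>" using B assms by (auto simp: block_def)
  moreover have "s \<in> block n s" using B assms by (auto simp: block_def)
  ultimately have "block n s = \<sigma>" using assms(1) by (auto simp: atoms_def)
  then show "cell n u = cell n s" using assms by (auto simp: block_def)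
qed

end

section \<open>Martingales of averages\<close>

lemma is_cond_expI:
  fixes X :: "'s \<Rightarrow> 'a::euclidean_space"
  assumes "finite_measure P" "subalgebra P F" and X: "integrable P X" and Y: "integrable P Y" "Y \<in> borel_measurable F"
    and eq: "\<And>A b. A \<in> sets F \<Longrightarrow> b \<in> Basis \<Longrightarrow> (\<integral>x\<in>A. X x \<bullet> b \<partial>P) = (\<integral>x\<in>A. Y x \<bullet> b \<partial>P)"
  shows "is_cond_exp P F X Y"
proof -
  interpret finite_measure_subalgebra P F
    using assms(1,2) by (simp add: finite_measure_subalgebra_def finite_measure_subalgebra_axioms_def)
  have "AE s in P. real_cond_exp P F (\<lambda>z. X z \<bullet> b) s = Y s \<bullet> b" if "b \<in> Basis" for b
    using that X Y eq by (intro real_cond_exp_charact) auto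
  then show ?thesis
    using X Y by (auto simp: is_cond_exp_def eq_commute)
qed

text \<open>This passes from gauge integrals, in which the cell computations are done, to the
  Lebesgue set integrals that characterize conditional expectations.\<close>

lemma set_integral_lebesgue_on_eq:
  fixes h :: "real \<Rightarrow> real"
  assumes h: "integrable (lebesgue_on {a..b}) h" and A: "A \<in> sets (lebesgue_on {a..b})"
    and int: "(h has_integral c) A"
  shows "(\<integral>x\<in>A. h x \<partial>lebesgue_on {a..b}) = c"
proof -
  have sub: "A \<subseteq> {a..b}" using A by (simp add: sets_restrict_space_iff)
  have "integrable (lebesgue_on {a..b}) (\<lambda>x. indicator A x *\<^sub>R h x)"
    using A h by (intro integrable_mult_indicator)
  then have "((\<lambda>x. indicator A x *\<^sub>R h x) has_integral (\<integral>x\<in>A. h x \<partial>lebesgue_on {a..b})) {a..b}"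
    unfolding set_lebesgue_integral_def by (intro has_integral_integral_lebesgue_on) auto
  moreover have "(\<lambda>x. indicator A x *\<^sub>R h x) = (\<lambda>x. if x \<in> A then h x else 0)"
    by auto
  moreover have "((\<lambda>x. if x \<in> A then h x else 0) has_integral c) {a..b}"
    using int sub by simp
  ultimately show ?thesis by (metis has_integral_unique)
qed

context bisection
begin

definition cavg :: "(real \<Rightarrow> 'a::euclidean_space) \<Rightarrow> nat \<Rightarrow> real \<Rightarrow> 'a" where
  "cavg f n s = (1 / (hi n s - lo n s)) *\<^sub>R integral {lo n s..hi n s} f"

lemma cavg_measurable: "cavg f n \<in> borel_measurable (part n)"
proof -
  have "cavg f n = (\<lambda>s. (\<lambda>(a, b). (1 / (b - a)) *\<^sub>R integral {a..b} f) (cell n s))"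
    by (simp add: fun_eq_iff cavg_def cell_eq)
  then show ?thesis using measurable_cell[of "\<lambda>(a, b). (1 / (b - a)) *\<^sub>R integral {a..b} f" borel n]
    by simp
qed

lemma subalgebra_part: "subalgebra std_space (part n)"
  using finite_filtration_part by (simp add: finite_filtration_def)

lemma finite_measure_std_space: "finite_measure std_space"
  using prob_space_std_space by (rule prob_space.finite_measure)

lemma cavg_integrable: "integrable std_space (cavg f n)"
proof -
  interpret finite_measure std_space by (rule finite_measure_std_space)
  \<comment> \<open>\<open>cavg f n s\<close> depends only on the label of \<open>s\<close>, so it
    takes finitely many values and the largest norm is a bound.\<close>
  have fin: "finite ((\<lambda>(a, b). norm ((1 / (b - a)) *\<^sub>R integral {a..b} f)) ` cell n ` UNIV)"
    by (intro finite_imageI finite_cells)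
  define B where "B = Max ((\<lambda>(a, b). norm ((1 / (b - a)) *\<^sub>R integral {a..b} f)) ` cell n ` UNIV)"
  have "norm (cavg f n s) \<le> B" for s
    unfolding B_def
    by (rule Max_ge[OF fin]) (auto simp: cavg_def cell_eq image_iff intro!: exI[of _ s])
  then show ?thesis
    using measurable_from_subalg[OF subalgebra_part cavg_measurable]
    by (intro integrable_const_bound[of _ B]) auto
qed

text \<open>On each block both functions integrate to the integral of \<open>f\<close> over the
  cell, and \<open>A\<close> is a finite disjoint union of blocks. It is enough to know that a
  common value exists, since integrals are unique.\<close>

lemma has_integral_part:
  fixes f :: "real \<Rightarrow> 'a::euclidean_space"
  assumes f: "f integrable_on {0..1}" and A: "A \<in> sets (part n)"
  obtains c where "(f has_integral c) A" "(cavg f n has_integral c) A"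
proof -
  obtain Q where Q: "finite Q" "Q \<subseteq> {0..1}" "A = (\<Union>s\<in>Q. block n s)" "disjoint_family_on (block n) Q"
    using part_setsE[OF A] by metis
  define g where "g s = integral {lo n s..hi n s} f" for s
  \<comment> \<open>A block differs from its closed cell at most by the right endpoint.\<close>
  have neg: "negligible {x \<in> {lo n s..hi n s} - block n s. P x}"
    "negligible {x \<in> block n s - {lo n s..hi n s}. P x}" if "s \<in> Q" for s P
  proof -
    have s: "s \<in> {0..1}" using that Q by auto
    have "{x \<in> {lo n s..hi n s} - block n s. P x} \<subseteq> {hi n s}"
      "{x \<in> block n s - {lo n s..hi n s}. P x} \<subseteq> {}"
      using block_bounds[OF s, of n] by force+
    then show "negligible {x \<in> {lo n s..hi n s} - block n s. P x}"
      "negligible {x \<in> block n s - {lo n s..hi n s}. P x}"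
      using negligible_subset[OF negligible_sing] negligible_subset[OF negligible_empty] by blast+
  qed
  have spike: "(h has_integral y) (block n s) \<longleftrightarrow> (h has_integral y) {lo n s..hi n s}"
    if "s \<in> Q" for s y and h :: "real \<Rightarrow> 'a"
    using neg[OF that] by (intro has_integral_spike_set_eq) auto
  have 1: "(f has_integral g s) (block n s)" if "s \<in> Q" for s
  proof -
    have "{lo n s..hi n s} \<subseteq> {0..1}" using cell_bounds[of s n] that Q by auto
    then have "f integrable_on {lo n s..hi n s}"
      using integrable_on_subinterval f by blast
    then show ?thesis unfolding spike[OF that] g_def by (rule integrable_integral)
  qed
  have 2: "(cavg f n has_integral g s) (block n s)" if "s \<in> Q" for s
  proof -
    have b: "lo n s < hi n s" using cell_bounds[of s n] that Q by auto
    have "((\<lambda>x. (1 / (hi n s - lo n s)) *\<^sub>R g s) has_integral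
        (hi n s - lo n s) *\<^sub>R (1 / (hi n s - lo n s)) *\<^sub>R g s) {lo n s..hi n s}"
      using has_integral_const_real[of "(1 / (hi n s - lo n s)) *\<^sub>R g s" "lo n s" "hi n s"] b
      by simp
    then have "((\<lambda>x. (1 / (hi n s - lo n s)) *\<^sub>R g s) has_integral g s) (block n s)"
      unfolding spike[OF that] using b by simp
    then show ?thesis
      by (rule has_integral_eq[rotated]) (auto simp: block_def cavg_def g_def lo_def hi_def)
  qed
  have pw: "pairwise (\<lambda>i i'. negligible (block n i \<inter> block n i')) Q"
    using Q(4) by (auto simp: pairwise_def disjoint_family_on_def)
  show thesis
    using that[of "sum g Q"] has_integral_UN[OF Q(1) 1 pw] has_integral_UN[OF Q(1) 2 pw]
    unfolding Q(3) by blast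
qed

lemma is_cond_exp_part:
  assumes X: "integrable std_space X" and Y: "Y = cavg f n"
    and eq: "\<And>A. A \<in> sets (part n) \<Longrightarrow> \<exists>c. (X has_integral c) A \<and> (Y has_integral c) A"
  shows "is_cond_exp std_space (part n) X Y"
proof (rule is_cond_expI[OF finite_measure_std_space subalgebra_part X])
  show Yi: "integrable std_space Y" "Y \<in> borel_measurable (part n)"
    unfolding Y by (rule cavg_integrable cavg_measurable)+
  fix A and b :: 'a
  assume A: "A \<in> sets (part n)" and b: "b \<in> Basis"
  obtain c where c: "(X has_integral c) A" "(Y has_integral c) A" using eq[OF A] by blast
  have "((\<lambda>x. X x \<bullet> b) has_integral c \<bullet> b) A" "((\<lambda>x. Y x \<bullet> b) has_integral c \<bullet> b) A"
    using c b has_integral_componentwise_iff by blast+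
  then have "(\<integral>x\<in>A. X x \<bullet> b \<partial>std_space) = c \<bullet> b" "(\<integral>x\<in>A. Y x \<bullet> b \<partial>std_space) = c \<bullet> b"
    using X Yi sets_part_lebesgue[OF A] unfolding std_space_def
    by (intro set_integral_lebesgue_on_eq; simp)+
  then show "(\<integral>x\<in>A. X x \<bullet> b \<partial>std_space) = (\<integral>x\<in>A. Y x \<bullet> b \<partial>std_space)" by simp
qed

lemma std_space_integrable_on:
  "integrable std_space f \<Longrightarrow> f integrable_on {0..1}" for f :: "real \<Rightarrow> 'a::euclidean_space"
  unfolding std_space_def by (rule integrable_on_lebesgue_on) auto

lemma is_cond_exp_cavg:
  assumes "integrable std_space f"
  shows "is_cond_exp std_space (part n) f (cavg f n)"
proof (rule is_cond_exp_part[OF assms refl])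
  fix A assume "A \<in> sets (part n)"
  from has_integral_part[OF std_space_integrable_on[OF assms] this]
  show "\<exists>c. (f has_integral c) A \<and> (cavg f n has_integral c) A" by blast
qed

text \<open>A set of \<open>part n\<close> also belongs to \<open>part (Suc n)\<close>, and over it
  the averages of both steps integrate to the integral of \<open>f\<close>.\<close>

lemma martingale_cavg:
  assumes f: "integrable std_space f"
  shows "martingale std_space part (cavg f)"
proof -
  have "is_cond_exp std_space (part n) (cavg f (Suc n)) (cavg f n)" for n
  proof (rule is_cond_exp_part[OF cavg_integrable refl])
    fix A assume A: "A \<in> sets (part n)"
    have "sets (part n) \<subseteq> sets (part (Suc n))"
      using finite_filtration_part by (auto simp: finite_filtration_def filtration_def)
    then have A': "A \<in> sets (part (Suc n))" using A by blast
    obtain c where c: "(f has_integral c) A" "(cavg f n has_integral c) A"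
      using has_integral_part[OF std_space_integrable_on[OF f] A] by blast
    obtain c' where c': "(f has_integral c') A" "(cavg f (Suc n) has_integral c') A"
      using has_integral_part[OF std_space_integrable_on[OF f] A'] by blast
    have "c = c'" using c(1) c'(1) by (rule has_integral_unique)
    then show "\<exists>c. (cavg f (Suc n) has_integral c) A \<and> (cavg f n has_integral c) A"
      using c c' by blast
  qed
  then show ?thesis
    by (simp add: martingale_def cavg_measurable cavg_integrable)
qed

section \<open>Almost everywhere convergence of the averages\<close>

text \<open>Stopping at the first suitable step covers the exceptional set by cells that coincide or
  have disjoint interiors. Finitely many of them, suitably tagged, form a partial division fine for
  the gauge, and Henstock's lemma bounds their total length.\<close>

lemma negligible_cavg_deviation:
  fixes f :: "real \<Rightarrow> 'a::euclidean_space"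
  assumes f: "f integrable_on {0..1}" and e: "0 < e"
    and len: "\<And>s. s \<in> {0..1} \<Longrightarrow> (\<lambda>n. hi n s - lo n s) \<longlonglongrightarrow> 0"
  shows "negligible {s \<in> {0..1}. \<exists>\<^sub>F n in sequentially. e \<le> norm (cavg f n s - f s)}"
    (is "negligible ?E")
proof -
  define E where "E = ?E"
  have E01: "s \<in> {0..1}" if "s \<in> E" for s using that by (simp add: E_def)
  have "\<exists>T. E \<subseteq> T \<and> T \<in> lmeasurable \<and> measure lebesgue T \<le> \<epsilon>" if "0 < \<epsilon>" for \<epsilon>
  proof -
    have f': "f integrable_on cbox 0 1" using f by simp
    \<comment> \<open>The tolerance is \<open>e * \<epsilon>\<close> because every selected interval
      will contribute at least \<open>e\<close> times its length to the sum.\<close>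
    obtain \<gamma> where \<gamma>: "gauge \<gamma>"
      and hen: "\<And>p. \<lbrakk>p tagged_partial_division_of (cbox 0 1); \<gamma> fine p\<rbrakk> \<Longrightarrow>
          (\<Sum>(x, k)\<in>p. norm (measure lborel k *\<^sub>R f x - integral k f)) < e * \<epsilon>"
      using Henstock_lemma[OF f', of "e * \<epsilon>"] mult_pos_pos[OF e \<open>0 < \<epsilon>\<close>] by blast
    define J where "J n s = {lo n s..hi n s}" for n s
    define good where "good n u \<longleftrightarrow> e \<le> norm (cavg f n u - f u) \<and> J n u \<subseteq> \<gamma> u" for n u
    \<comment> \<open>The tag \<open>u\<close> may be any point of the block, so that
      \<open>G n s\<close> depends only on the cell of \<open>s\<close>. This makes the first step
      \<open>N\<close> constant on the selected cell.\<close>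
    define G where "G n s \<longleftrightarrow> (\<exists>u\<in>block n s. good n u)" for n s
    define N where "N s = (LEAST n. G n s)" for s
    have J_block: "J n u = J n s" if "u \<in> block n s" for n u s
      using that by (simp add: block_def J_def lo_def hi_def)
    have G_ex: "\<exists>n. G n s" if "s \<in> E" for s
    proof -
      have s: "s \<in> {0..1}" using that by (rule E01)
      \<comment> \<open>A cell of \<open>s\<close> shorter than \<open>r\<close> fits the gauge at
        \<open>s\<close>. Cells are eventually that short, while the deviation is large infinitely
        often, so both happen at a common step.\<close>
      obtain r where r: "0 < r" "ball s r \<subseteq> \<gamma> s"
        using \<gamma> by (metis gaugeD openE)
      have "\<forall>\<^sub>F n in sequentially. hi n s - lo n s < r"
        using order_tendstoD(2)[OF len[OF s] r(1)] .
      moreover have "\<exists>\<^sub>F n in sequentially. e \<le> norm (cavg f n s - f s)" using that by (simp add: E_def)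
      ultimately have "\<exists>\<^sub>F n in sequentially. e \<le> norm (cavg f n s - f s) \<and> hi n s - lo n s < r"
        by (simp add: frequently_eventually_conj conj_commute)
      then obtain n where n: "e \<le> norm (cavg f n s - f s)" "hi n s - lo n s < r"
        using frequently_ex by blast
      have "J n s \<subseteq> ball s r"
        using n(2) cell_bounds[OF s, of n] by (auto simp: J_def dist_real_def)
      then have "good n s" using n r by (auto simp: good_def)
      then show ?thesis using s by (auto simp: G_def block_def)
    qed
    have GN: "G (N s) s" if "s \<in> E" for s
      unfolding N_def by (rule LeastI_ex[OF G_ex[OF that]])
    have N_le: "N s \<le> n" if "G n s" for n s
      using that unfolding N_def by (rule Least_le)
    \<comment> \<open>An earlier step for \<open>w\<close> would also serve \<open>s\<close>,
      because equal labels at step \<open>N s\<close> entail equal labels at all earlier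
      steps.\<close>
    have N_eq: "N w = N s" if s: "s \<in> E" and w: "w \<in> block (N s) s" for s w
    proof -
      have cw: "w \<in> {0..1}" "cell (N s) w = cell (N s) s" using w by (auto simp: block_def)
      then have "G (N s) w" using GN[OF s] by (simp add: G_def block_def)
      then have le: "N w \<le> N s" by (rule N_le)
      have "G (N w) w"
        unfolding N_def by (rule LeastI) fact
      moreover have "cell (N w) w = cell (N w) s"
        using cell_refine_le[OF le cw(1) E01[OF s] cw(2)] .
      ultimately have "G (N w) s" by (simp add: G_def block_def)
      then show ?thesis using le N_le by (simp add: order_antisym)
    qed
    define D where "D = (\<lambda>s. J (N s) s) ` E"
    have "D \<subseteq> (\<Union>n. (\<lambda>(a, b). {a..b}) ` (cell n ` UNIV))"
      by (auto simp: D_def J_def cell_eq image_iff)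
    then have count: "countable D"
      by (rule countable_subset) (intro countable_UN countable_image countable_finite finite_cells countableI_type)
    have D_meas: "K \<in> lmeasurable" if "K \<in> D" for K
      using that by (auto simp: D_def J_def)
    have bound: "measure lebesgue (\<Union>D') \<le> \<epsilon>" if D': "D' \<subseteq> D" "finite D'" for D'
    proof -
      define R where "R K u \<longleftrightarrow> (\<exists>s\<in>E. K = J (N s) s \<and> u \<in> block (N s) s \<and> good (N s) u)" for K u
      have "\<exists>u. R K u" if "K \<in> D'" for K
      proof -
        have "K \<in> D" using that D' by blast
        then obtain s where s: "s \<in> E" "K = J (N s) s" by (auto simp: D_def)
        then show ?thesis using GN[OF s(1)] by (auto simp: G_def R_def)
      qed
      then obtain U where U: "\<And>K. K \<in> D' \<Longrightarrow> R K (U K)"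
        by metis
      \<comment> \<open>An interior point recovers the selected interval as
        \<open>J (N w) w\<close>, so selected intervals with a common interior point coincide.
        Endpoints are left out since neighbouring closed cells share them.\<close>
      have J_inside: "J (N w) w = J (N s) s" if "s \<in> E" "w \<in> interior (J (N s) s)" for s w
      proof -
        have "w \<in> {lo (N s) s..<hi (N s) s}" using that(2) by (simp add: J_def)
        then have "w \<in> block (N s) s" using block_bounds(1)[OF E01[OF that(1)]] by blast
        then show ?thesis using N_eq[OF that(1)] J_block by simp
      qed
      have disj: "interior K1 \<inter> interior K2 = {}" if K: "K1 \<in> D'" "K2 \<in> D'" "K1 \<noteq> K2" for K1 K2
      proof (rule ccontr)
        assume "interior K1 \<inter> interior K2 \<noteq> {}"
        then obtain w where w: "w \<in> interior K1" "w \<in> interior K2" by blast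
        have *: "J (N w) w = K" if "K \<in> D'" "w \<in> interior K" for K
        proof -
          obtain s where "s \<in> E" "K = J (N s) s"
            using U[OF \<open>K \<in> D'\<close>] unfolding R_def by blast
          then show ?thesis using J_inside that(2) by simp
        qed
        show False using *[OF K(1) w(1)] *[OF K(2) w(2)] K(3) by simp
      qed
      define p where "p = (\<lambda>K. (U K, K)) ` D'"
      \<comment> \<open>The integral over \<open>K\<close> is its length times the average, so each
        Henstock term equals the length times the deviation at the tag, which is at least
        \<open>e\<close>.\<close>
      have "K \<subseteq> {0..1}" "\<exists>a b. K = cbox a b" "U K \<in> K" "K \<subseteq> \<gamma> (U K)"
        "e * measure lborel K \<le> norm (measure lborel K *\<^sub>R f (U K) - integral K f)" if KD: "K \<in> D'" for K
      proof -
        obtain s n u where s: "s \<in> {0..1}" "K = J n s" and u: "u \<in> block n s" "good n u"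
          and uK: "U K = u"
          using U[OF KD] E01 unfolding R_def by blast
        define l h where "l = lo n u" and "h = hi n u"
        have u01: "u \<in> {0..1}" using u(1) by (simp add: block_def)
        then have lh: "l < h" "0 \<le> l" "h \<le> 1" "l \<le> u" "u \<le> h"
          using cell_bounds[OF u01, of n] by (simp_all add: l_def h_def)
        have K: "K = J n u" using s(2) J_block[OF u(1)] by simp
        have K': "K = {l..h}" by (simp add: K J_def l_def h_def)
        show "K \<subseteq> {0..1}" "U K \<in> K" using lh unfolding uK by (auto simp: K')
        show "\<exists>a b. K = cbox a b" using K' by (metis box_real(2))
        show "K \<subseteq> \<gamma> (U K)" using u(2) unfolding uK by (simp add: good_def K)
        have c: "measure lborel K = h - l" using lh by (simp add: K')
        have "integral K f = (h - l) *\<^sub>R cavg f n u"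
          using lh(1) unfolding K' cavg_def l_def[symmetric] h_def[symmetric] by simp
        then have "norm (measure lborel K *\<^sub>R f u - integral K f) = norm ((h - l) *\<^sub>R (f u - cavg f n u))"
          by (simp add: c scaleR_diff_right)
        also have "\<dots> = (h - l) * norm (cavg f n u - f u)"
          using lh(1) by (simp add: norm_minus_commute)
        also have "\<dots> \<ge> (h - l) * e"
          using u(2) lh(1) by (intro mult_left_mono) (auto simp: good_def)
        finally show "e * measure lborel K \<le> norm (measure lborel K *\<^sub>R f (U K) - integral K f)"
          unfolding uK by (simp add: c mult.commute)
      qed
      note props = this
      have "p tagged_partial_division_of cbox 0 1"
        unfolding tagged_partial_division_of_def
      proof (intro conjI allI impI)
        show "finite p" using D' by (simp add: p_def)
        show "x \<in> K" "K \<subseteq> cbox 0 1" "\<exists>a b. K = cbox a b" if "(x, K) \<in> p" for x K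
          using props[of K] that by (auto simp: p_def)
        show "interior K1 \<inter> interior K2 = {}"
          if "(x1, K1) \<in> p \<and> (x2, K2) \<in> p \<and> (x1, K1) \<noteq> (x2, K2)" for x1 K1 x2 K2
          using that by (intro disj) (auto simp: p_def)
      qed
      moreover have "\<gamma> fine p" using props by (auto simp: fine_def p_def)
      ultimately have "(\<Sum>(x, k)\<in>p. norm (measure lborel k *\<^sub>R f x - integral k f)) < e * \<epsilon>"
        by (rule hen)
      also have "(\<Sum>(x, k)\<in>p. norm (measure lborel k *\<^sub>R f x - integral k f))
          = (\<Sum>K\<in>D'. norm (measure lborel K *\<^sub>R f (U K) - integral K f))"
        unfolding p_def by (subst sum.reindex) (auto simp: inj_on_def)
      finally have lt: "(\<Sum>K\<in>D'. norm (measure lborel K *\<^sub>R f (U K) - integral K f)) < e * \<epsilon>" .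
      have "(\<Sum>K\<in>D'. e * measure lborel K) \<le> (\<Sum>K\<in>D'. norm (measure lborel K *\<^sub>R f (U K) - integral K f))"
        by (rule sum_mono) (rule props)
      then have "e * (\<Sum>K\<in>D'. measure lborel K) < e * \<epsilon>" using lt by (simp add: sum_distrib_left)
      then have "(\<Sum>K\<in>D'. measure lborel K) < \<epsilon>" using e by simp
      moreover have "measure lebesgue (\<Union>D') \<le> (\<Sum>K\<in>D'. measure lebesgue K)"
        using D_meas D' by (intro measure_Union_le) auto
      moreover have "(\<Sum>K\<in>D'. measure lebesgue K) = (\<Sum>K\<in>D'. measure lborel K)"
      proof (rule sum.cong[OF refl])
        fix K assume "K \<in> D'"
        then obtain a b where "K = cbox a b" using props(2)[OF \<open>K \<in> D'\<close>] by blast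
        then show "measure lebesgue K = measure lborel K" by simp
      qed
      ultimately show ?thesis by simp
    qed
    have "E \<subseteq> \<Union>D"
    proof
      fix s assume "s \<in> E"
      moreover have "s \<in> J (N s) s" using cell_bounds[OF E01[OF calculation], of "N s"] by (simp add: J_def)
      ultimately show "s \<in> \<Union>D" by (auto simp: D_def)
    qed
    then show "\<exists>T. E \<subseteq> T \<and> T \<in> lmeasurable \<and> measure lebesgue T \<le> \<epsilon>"
      using fmeasurable_Union_bound[OF count D_meas bound] measure_Union_bound[OF count D_meas bound] by blast
  qed
  then show ?thesis unfolding E_def by (simp add: negligible_outer_le)
qed

lemma cavg_tendsto_AE:
  fixes f :: "real \<Rightarrow> 'a::euclidean_space"
  assumes f: "integrable std_space f"
    and len: "\<And>s. s \<in> {0..1} \<Longrightarrow> (\<lambda>n. hi n s - lo n s) \<longlonglongrightarrow> 0"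
  shows "AE s in std_space. (\<lambda>n. cavg f n s) \<longlonglongrightarrow> f s"
proof -
  define E where "E e = {s \<in> {0..1}. \<exists>\<^sub>F n in sequentially. e \<le> norm (cavg f n s - f s)}" for e
  have "negligible (E (1 / real (Suc k)))" for k
    unfolding E_def by (intro negligible_cavg_deviation std_space_integrable_on f len) auto
  then have "negligible (\<Union>k. E (1 / real (Suc k)))"
    by (intro negligible_Union_nat)
  then have "AE s in lebesgue. s \<notin> (\<Union>k. E (1 / real (Suc k)))"
    unfolding negligible_iff_null_sets by (rule AE_not_in)
  moreover have "(\<lambda>n. cavg f n s) \<longlonglongrightarrow> f s" if "s \<in> {0..1}" "s \<notin> (\<Union>k. E (1 / real (Suc k)))" for s
    unfolding tendsto_iff
  proof (intro allI impI)
    fix e :: real assume "0 < e"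
    then obtain k where k: "1 / real (Suc k) < e" using nat_approx_posE by blast
    have "\<not> (\<exists>\<^sub>F n in sequentially. 1 / real (Suc k) \<le> norm (cavg f n s - f s))"
      using that by (auto simp: E_def)
    then have "\<forall>\<^sub>F n in sequentially. norm (cavg f n s - f s) < 1 / real (Suc k)"
      by (simp add: frequently_def not_le)
    then show "\<forall>\<^sub>F n in sequentially. dist (cavg f n s) (f s) < e"
      using k by (auto simp: dist_norm elim!: eventually_mono)
  qed
  ultimately show ?thesis
    unfolding std_space_def by (subst AE_restrict_space_iff) (auto elim!: eventually_mono)
qed

section \<open>Shrinking of the cells\<close>

lemma length_tendsto_0:
  fixes F :: "real \<Rightarrow> 'a::euclidean_space"
  assumes F: "continuous_on {0..1} F"
    and avoid: "\<And>x y. 0 \<le> x \<Longrightarrow> x < y \<Longrightarrow> y \<le> 1 \<Longrightarrow> slope F x y \<notin> closure W"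
    and step: "\<And>n s. s \<in> {0..1} \<Longrightarrow> hi (Suc n) s - lo (Suc n) s \<le> (hi n s - lo n s) / 2 \<or>
        closed_segment (slope F (lo n s) (hi n s)) (slope F (lo (Suc n) s) (hi (Suc n) s)) \<inter> closure W \<noteq> {}"
    and s: "s \<in> {0..1}"
  shows "(\<lambda>n. hi n s - lo n s) \<longlonglongrightarrow> 0"
proof -
  note b = cell_bounds[OF s]
  have mono: "lo n s \<le> lo (Suc n) s" "hi (Suc n) s \<le> hi n s" for n
    using sp[of "lo n s" "hi n s"] b[of n] by (auto simp: lo_Suc hi_Suc)
  obtain \<alpha> where \<alpha>: "(\<lambda>n. lo n s) \<longlonglongrightarrow> \<alpha>" "\<And>n. lo n s \<le> \<alpha>"
    using incseq_convergent[of "\<lambda>n. lo n s" 1] mono b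
    by (metis incseq_SucI order_trans)
  obtain \<beta> where \<beta>: "(\<lambda>n. hi n s) \<longlonglongrightarrow> \<beta>" "\<And>n. \<beta> \<le> hi n s"
    using decseq_convergent[of "\<lambda>n. hi n s" 0] mono b
    by (metis decseq_SucI order_trans)
  have \<alpha>\<beta>: "\<alpha> \<le> \<beta>"
    using b by (intro LIMSEQ_le[OF \<alpha>(1) \<beta>(1)]) (auto intro: less_imp_le)
  have lim: "(\<lambda>n. hi n s - lo n s) \<longlonglongrightarrow> \<beta> - \<alpha>"
    by (intro tendsto_intros \<alpha> \<beta>)
  have "\<alpha> = \<beta>"
  proof (rule ccontr)
    assume "\<alpha> \<noteq> \<beta>"
    then have lt: "\<alpha> < \<beta>" using \<alpha>\<beta> by simp
    have in01: "0 \<le> \<alpha>" "\<beta> \<le> 1" "\<alpha> \<in> {0..1}" "\<beta> \<in> {0..1}"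
      using \<alpha>(2)[of 0] \<beta>(2)[of 0] lt by auto
    define m where "m n = slope F (lo n s) (hi n s)" for n
    have mlim: "m \<longlonglongrightarrow> slope F \<alpha> \<beta>"
      unfolding m_def slope_def
    proof (intro tendsto_intros)
      have "0 \<le> hi n s" "lo n s \<le> 1" for n
        using b[of n] by linarith+
      note b = b this
      show "(\<lambda>n. F (hi n s)) \<longlonglongrightarrow> F \<beta>"
        using b by (intro continuous_on_tendsto_compose[OF F \<beta>(1) in01(4)] always_eventually)
          auto
      show "(\<lambda>n. F (lo n s)) \<longlonglongrightarrow> F \<alpha>"
        using b by (intro continuous_on_tendsto_compose[OF F \<alpha>(1) in01(3)] always_eventually)
          auto
    qed (use lt \<alpha> \<beta> in auto)
    have "\<forall>\<^sub>F n in sequentially. hi n s - lo n s < 2 * (\<beta> - \<alpha>)"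
      using lt by (intro order_tendstoD(2)[OF lim]) auto
    then obtain n0 where n0: "\<And>n. n0 \<le> n \<Longrightarrow> hi n s - lo n s < 2 * (\<beta> - \<alpha>)"
      by (auto simp: eventually_sequentially)
    \<comment> \<open>From \<open>n0\<close> on, a halved cell would be shorter than the limit
      interval, which every cell contains; so the touching alternative of \<open>step\<close>
      holds.\<close>
    have "\<exists>p. p \<in> closed_segment (m n) (m (Suc n)) \<and> p \<in> closure W" if "n0 \<le> n" for n
    proof -
      have "\<not> hi (Suc n) s - lo (Suc n) s \<le> (hi n s - lo n s) / 2"
        using n0[OF that] \<alpha>(2)[of "Suc n"] \<beta>(2)[of "Suc n"] by (simp add: field_simps)
      then show ?thesis using step[OF s, of n] by (auto simp: m_def)
    qed
    then obtain p where p: "\<And>n. n0 \<le> n \<Longrightarrow> p n \<in> closed_segment (m n) (m (Suc n)) \<and> p n \<in> closure W"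
      by metis
    have d0: "(\<lambda>n. dist (m n) (m (Suc n))) \<longlonglongrightarrow> 0"
      using tendsto_dist[OF mlim LIMSEQ_Suc[OF mlim]] by simp
    \<comment> \<open>The touching points lie between consecutive averages, whose distance tends to
      0, so they share the limit of the averages.\<close>
    have "(\<lambda>n. p n - m n) \<longlonglongrightarrow> 0"
    proof (rule Lim_null_comparison[OF _ d0])
      show "\<forall>\<^sub>F n in sequentially. norm (p n - m n) \<le> dist (m n) (m (Suc n))"
      proof (rule eventually_sequentiallyI[of n0])
        fix n assume "n0 \<le> n"
        then have "p n \<in> closed_segment (m n) (m (Suc n))" using p by blast
        from dist_in_closed_segment[OF this] show "norm (p n - m n) \<le> dist (m n) (m (Suc n))"
          by (simp add: dist_norm)
      qed
    qed
    from tendsto_add[OF this mlim] have "p \<longlonglongrightarrow> slope F \<alpha> \<beta>" by simp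
    then have "slope F \<alpha> \<beta> \<in> closure W"
      using p by (intro Lim_in_closed_set[OF closed_closure]) (auto simp: eventually_sequentially)
    \<comment> \<open>\<open>avoid\<close> is applied to the limit interval, which need not be a
      cell; hence it is stated for all subintervals.\<close>
    then show False using avoid[of \<alpha> \<beta>] lt in01 by auto
  qed
  then show ?thesis using lim by simp
qed

end

section \<open>The unit interval\<close>

text \<open>Otherwise a hyperplane strictly separates the mean from \<open>S\<close>, and
  integrating the resulting inequality for \<open>f\<close> over the interval contradicts the
  position of the mean.\<close>

lemma mean_in_closed_convex:
  fixes f :: "real \<Rightarrow> 'a::euclidean_space"
  assumes S: "convex S" "closed S" and f: "f integrable_on {a..b}" and ab: "a < b"
    and mem: "\<And>x. x \<in> {a..b} \<Longrightarrow> f x \<in> S"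
  shows "(1 / (b - a)) *\<^sub>R integral {a..b} f \<in> S"
proof (rule ccontr)
  define z where "z = (1 / (b - a)) *\<^sub>R integral {a..b} f"
  assume "(1 / (b - a)) *\<^sub>R integral {a..b} f \<notin> S"
  then obtain n c where nc: "n \<bullet> z < c" "\<And>x. x \<in> S \<Longrightarrow> c < n \<bullet> x"
    using separating_hyperplane_closed_point[OF S, of z] by (auto simp: z_def)
  have "(\<lambda>x. f x \<bullet> n) integrable_on {a..b}"
    using integrable_linear[OF f bounded_linear_inner_left[of n]] by (simp add: o_def)
  then have "integral {a..b} (\<lambda>x. c) \<le> integral {a..b} (\<lambda>x. f x \<bullet> n)"
    using nc(2)[OF mem] by (intro integral_le) (auto simp: inner_commute intro: less_imp_le)
  also have "\<dots> = integral {a..b} f \<bullet> n" using f by simp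
  also have "integral {a..b} f = (b - a) *\<^sub>R z" using ab by (simp add: z_def)
  finally have "c * (b - a) \<le> (z \<bullet> n) * (b - a)" using ab by (simp add: mult.commute)
  then show False using nc(1) ab by (simp add: inner_commute)
qed

text \<open>Suppose an open segment in \<open>closure U\<close> contains a frontier point
  \<open>x\<close>. It cannot meet the open convex set \<open>U\<close>, as \<open>x\<close> would
  then lie strictly between a point of \<open>U\<close> and an endpoint in \<open>closure U\<close>,
  hence in \<open>U\<close>. So it lies in the frontier, which contains no segments.\<close>

lemma frontier_subset_fixed_boundary:
  fixes U W :: "'a::euclidean_space set"
  assumes U: "open U" "convex U" "\<not> contains_segment (frontier U)" and W: "open W" "W \<subseteq> U"
  shows "frontier U \<subseteq> fixed_boundary (closure U - W)"
proof
  fix x assume "x \<in> frontier U"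
  then have x: "x \<in> closure U" "x \<notin> U" using U(1) by (auto simp: frontier_def interior_open)
  have iU: "interior U = U" using U(1) by (rule interior_open)
  have cl: "closure (closure U - W) = closure U - W"
    using W(1) by (simp add: closed_Diff)
  have "x \<notin> interior (closure U - W)"
    using interior_mono[of "closure U - W" "closure U"] convex_interior_closure[OF U(2)] x(2) iU by auto
  then have fr: "x \<in> frontier (closure U - W)"
    using x W(2) by (auto simp: frontier_def cl)
  have False if ab: "a \<noteq> b" "x \<in> open_segment a b" "open_segment a b \<subseteq> closure (closure U - W)" for a b
  proof -
    have sub: "open_segment a b \<subseteq> closure U" using ab(3) cl by blast
    then have csub: "closed_segment a b \<subseteq> closure U"
      using closure_minimal[OF sub closed_closure] ab(1) by simp
    have "y \<notin> U" if y: "y \<in> open_segment a b" for y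
    proof
      assume "y \<in> U"
      have y': "y \<in> closed_segment a b" using y by (simp add: open_segment_def)
      have xa: "x \<in> closed_segment a b" "x \<noteq> a" "x \<noteq> b" "x \<noteq> y"
        using ab(2) x(2) \<open>y \<in> U\<close> by (auto simp: open_segment_def)
      have "x \<in> open_segment y a \<or> x \<in> open_segment y b"
        using Un_closed_segment[OF y'] xa by (auto simp: open_segment_def closed_segment_commute)
      moreover have "open_segment y z \<subseteq> interior U" if "z \<in> closure U" for z
        using in_interior_closure_convex_segment[OF U(2) _ that] \<open>y \<in> U\<close> iU by blast
      moreover have "a \<in> closure U" "b \<in> closure U" using csub by auto
      ultimately show False using x(2) iU by blast
    qed
    then have "open_segment a b \<subseteq> frontier U" using sub iU by (auto simp: frontier_def)
    then have "closure (open_segment a b) \<subseteq> frontier U"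
      by (rule closure_minimal) (rule frontier_closed)
    then have "closed_segment a b \<subseteq> frontier U"
      using ab(1) by simp
    then show False using U(3) ab(1) by (auto simp: contains_segment_def)
  qed
  then show "x \<in> fixed_boundary (closure U - W)"
    using fr by (auto simp: fixed_boundary_def)
qed

text \<open>\<open>f\<close> itself is the terminal variable, so it has to take frontier values at
  every point and not only almost everywhere.\<close>

lemma unit_interval_martingale:
  fixes f :: "real \<Rightarrow> 'a::euclidean_space"
  assumes U: "open U" "convex U" "\<not> contains_segment (frontier U)"
    and W: "open W" "convex W" "W \<subseteq> U"
    and f: "integrable std_space f" and fr: "\<And>s. s \<in> {0..1} \<Longrightarrow> f s \<in> frontier U"
    and avoid: "\<And>x y. 0 \<le> x \<Longrightarrow> x < y \<Longrightarrow> y \<le> 1 \<Longrightarrow> (1 / (y - x)) *\<^sub>R integral {x..y} f \<notin> closure W"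
  obtains S M where "w_martingale std_space (closure U - W) S M"
    "terminal_value std_space (closure U - W) S M f"
proof -
  define F where "F t = integral {0..t} f" for t
  have fi: "f integrable_on {0..1}"
    using f unfolding std_space_def by (intro integrable_on_lebesgue_on) auto
  have F: "continuous_on {0..1} F"
    unfolding F_def by (rule indefinite_integral_continuous_1[OF fi])
  have fsub: "f integrable_on {x..y}" if "0 \<le> x" "y \<le> 1" for x y
    using that by (intro integrable_subinterval_real[OF fi]) auto
  have slope: "slope F x y = (1 / (y - x)) *\<^sub>R integral {x..y} f" if "0 \<le> x" "x < y" "y \<le> 1" for x y
  proof -
    have "integral {0..x} f + integral {x..y} f = integral {0..y} f"
      using that by (intro Henstock_Kurzweil_Integration.integral_combine fsub) auto
    then have "F y - F x = integral {x..y} f" by (simp add: F_def algebra_simps)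
    then show ?thesis by (simp add: slope_def)
  qed
  have avoid': "slope F x y \<notin> closure W" if "0 \<le> x" "x < y" "y \<le> 1" for x y
    using avoid slope that by simp
  have mem: "slope F x y \<in> closure U" if "0 \<le> x" "x < y" "y \<le> 1" for x y
    unfolding slope[OF that] using that fr
    by (intro mean_in_closed_convex fsub convex_closure U) (auto simp: frontier_def)
  define good where "good a b t \<longleftrightarrow> a < t \<and> t < b \<and>
      closed_segment (slope F a t) (slope F t b) \<inter> W = {} \<and>
      (t - a \<le> (b - a) / 2 \<or> closed_segment (slope F a b) (slope F a t) \<inter> closure W \<noteq> {}) \<and>
      (b - t \<le> (b - a) / 2 \<or> closed_segment (slope F a b) (slope F t b) \<inter> closure W \<noteq> {})" for a b t
  have "\<exists>t. good a b t" if "0 \<le> a" "a < b" "b \<le> 1" for a b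
  proof -
    have cont: "continuous_on {a..b} F" using that by (intro continuous_on_subset[OF F]) auto
    have av: "slope F x y \<notin> closure W" if "a \<le> x" "x < y" "y \<le> b" for x y
      using that \<open>0 \<le> a\<close> \<open>b \<le> 1\<close> by (intro avoid') auto
    show ?thesis
      by (rule split_point[OF cont that(2) W(1,2) av]) (unfold good_def, blast+)
  qed
  then obtain sp where good: "\<And>a b. 0 \<le> a \<Longrightarrow> a < b \<Longrightarrow> b \<le> 1 \<Longrightarrow> good a b (sp a b)"
    by metis
  interpret bisection sp
    using good by unfold_locales (auto simp: good_def)
  have cavg: "cavg f n s = slope F (lo n s) (hi n s)" if "s \<in> {0..1}" for n s
    unfolding cavg_def using cell_bounds[OF that] by (subst slope) auto
  have good': "good (lo n s) (hi n s) (sp (lo n s) (hi n s))" if "s \<in> {0..1}" for n s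
    using cell_bounds[OF that] by (intro good)
  \<comment> \<open>Whichever part contains \<open>s\<close>, the matching alternative in
    \<open>good\<close> supplies the step condition.\<close>
  have len: "(\<lambda>n. hi n s - lo n s) \<longlonglongrightarrow> 0" if "s \<in> {0..1}" for s
    using good' by (intro length_tendsto_0[OF F avoid' _ that]) (auto simp: good_def lo_Suc hi_Suc)
  have conv: "convex hull (cavg f n ` \<sigma> \<union> cavg f (Suc n) ` \<sigma>) \<subseteq> closure U - W"
    if \<sigma>: "\<sigma> \<in> atoms (part n)" for n \<sigma>
  proof -
    obtain s where s: "s \<in> \<sigma>" using \<sigma> by (auto simp: atoms_def)
    have s01: "s \<in> {0..1}" using atom_part_cell_eq(1)[OF \<sigma> s s] .
    define a b t where "a = lo n s" and "b = hi n s" and "t = sp a b"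
    have ab: "0 \<le> a" "a < b" "b \<le> 1" using cell_bounds[OF s01, of n] by (simp_all add: a_def b_def)
    have g: "a < t" "t < b" "closed_segment (slope F a t) (slope F t b) \<inter> W = {}"
      using good[OF ab] by (simp_all add: good_def t_def)
    \<comment> \<open>On an atom, \<open>cavg f n\<close> is the mean of the cell and
      \<open>cavg f (Suc n)\<close> takes only the means of its two parts, so all values lie on one
      segment.\<close>
    have "cavg f n u \<in> closed_segment (slope F a t) (slope F t b)"
      "cavg f (Suc n) u \<in> closed_segment (slope F a t) (slope F t b)" if u: "u \<in> \<sigma>" for u
    proof -
      have u01: "u \<in> {0..1}" using atom_part_cell_eq(1)[OF \<sigma> u s] .
      have "cell n u = cell n s" using atom_part_cell_eq(2)[OF \<sigma> s u] .
      then have lh: "lo n u = a" "hi n u = b" by (simp_all add: lo_def hi_def a_def b_def)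
      show "cavg f n u \<in> closed_segment (slope F a t) (slope F t b)"
        unfolding cavg[OF u01] lh by (rule slope_in_closed_segment[OF g(1,2)])
      show "cavg f (Suc n) u \<in> closed_segment (slope F a t) (slope F t b)"
        unfolding cavg[OF u01] lo_Suc hi_Suc lh t_def[symmetric] by auto
    qed
    then have "convex hull (cavg f n ` \<sigma> \<union> cavg f (Suc n) ` \<sigma>) \<subseteq> closed_segment (slope F a t) (slope F t b)"
      by (intro hull_minimal) auto
    moreover have "closed_segment (slope F a t) (slope F t b) \<subseteq> closure U"
      using ab g U by (intro closed_segment_subset mem convex_closure) auto
    ultimately show ?thesis using g(3) by blast
  qed
  have "closed_by std_space (closure U - W) part (cavg f) f"
    unfolding closed_by_def
    using f fr frontier_subset_fixed_boundary[OF U W(1,3)] is_cond_exp_cavg[OF f]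
    by (auto simp: std_space_def)
  then show thesis
    using that[of part "cavg f"] finite_filtration_part martingale_cavg[OF f] sets_part_0 conv
      cavg_tendsto_AE[OF f len]
    unfolding w_martingale_def terminal_value_def by blast
qed

section \<open>General intervals\<close>

lemma proper_interval_bounds:
  assumes "proper_interval I"
  obtains u v where "u < v" "{u<..<v} \<subseteq> I" "I \<subseteq> {u..v}"
proof -
  have I: "is_interval I" "bounded I" "interior I \<noteq> {}" using assms by (auto simp: proper_interval_def)
  define u v where "u = Inf I" and "v = Sup I"
  have ne: "I \<noteq> {}" using I(3) interior_subset by blast
  have bdd: "bdd_above I" "bdd_below I" using I(2) bounded_imp_bdd_above bounded_imp_bdd_below by auto
  have sub: "I \<subseteq> {u..v}" using bdd by (auto simp: u_def v_def cInf_lower cSup_upper)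
  have "{u<..<v} \<subseteq> I"
  proof
    fix x assume x: "x \<in> {u<..<v}"
    obtain a where "a \<in> I" "a < x" using x cInf_less_iff[OF ne bdd(2)] by (auto simp: u_def)
    moreover obtain b where "b \<in> I" "x < b" using x less_cSup_iff[OF ne bdd(1)] by (auto simp: v_def)
    ultimately show "x \<in> I" using I(1) unfolding is_interval_1 by (meson less_imp_le)
  qed
  moreover have "u < v"
  proof (rule ccontr)
    assume "\<not> u < v"
    then have "I \<subseteq> {u}" using sub by auto
    then have "interior I \<subseteq> interior {u}" by (rule interior_mono)
    then show False using I(3) by simp
  qed
  ultimately show thesis using that sub by blast
qed

lemma has_integral_rescale:
  fixes g :: "real \<Rightarrow> 'a::euclidean_space"
  assumes "(g has_integral i) {u + c * x..u + c * y}" "0 < c"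
  shows "((\<lambda>s. g (u + c * s)) has_integral (1 / c) *\<^sub>R i) {x..y}"
proof -
  have "((\<lambda>s. g (c *\<^sub>R s + u)) has_integral i /\<^sub>R c ^ DIM(real))
      (cbox ((u + c * x - u) /\<^sub>R c) ((u + c * y - u) /\<^sub>R c))"
    using assms by (intro has_integral_affinity') auto
  then show ?thesis using assms(2) by (simp add: add.commute inverse_eq_divide)
qed

theorem theorem3p7:
  fixes \<Omega>0 \<Omega>1 \<Omega> \<Omega>t :: "(real ^ 2) set"
    and I :: "real set"
    and \<phi> :: "real \<Rightarrow> real ^ 2"
  assumes "\<Omega>0 \<noteq> {}" "open \<Omega>0" "convex \<Omega>0" "\<not> contains_line \<Omega>0"
    and "open \<Omega>1" "convex \<Omega>1" "closure \<Omega>1 \<subseteq> \<Omega>0"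
    and "\<Omega> = closure (\<Omega>0 - \<Omega>1)"
    and "\<not> contains_segment (frontier \<Omega>0)" "\<not> contains_segment (frontier \<Omega>1)"
    and "\<not> bounded \<Omega>0"
    and "rays_translate_into \<Omega>0 \<Omega>1"
    and "is_extension \<Omega>0 \<Omega>1 \<Omega>t"
    and "proper_interval I"
    and "\<phi> \<in> class_A \<Omega>0 \<Omega>1 I"
  shows "\<exists>S M M_inf.
           w_martingale std_space \<Omega>t S M \<and>
           terminal_value std_space \<Omega>t S M M_inf \<and>
           equimeasurable std_space M_inf I \<phi>"
proof -
  obtain W where W: "\<Omega>t = closure \<Omega>0 - W" "convex W" "open W" "closure W \<subseteq> \<Omega>1"
    using \<open>is_extension \<Omega>0 \<Omega>1 \<Omega>t\<close> by (auto simp: is_extension_def)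
  have "W \<subseteq> \<Omega>0"
    using W(4) \<open>closure \<Omega>1 \<subseteq> \<Omega>0\<close> closure_subset[of W] closure_subset[of \<Omega>1] by blast
  obtain u v where uv: "u < v" "{u<..<v} \<subseteq> I" "I \<subseteq> {u..v}"
    using proper_interval_bounds[OF \<open>proper_interval I\<close>] by blast
  define c where "c = v - u"
  have c: "0 < c" using uv(1) by (simp add: c_def)
  have "is_interval I" "bounded I" using \<open>proper_interval I\<close> by (auto simp: proper_interval_def)
  then have Im: "I \<in> lmeasurable" by (simp add: is_interval_convex measurable_convex)
  then have Is: "I \<in> sets lebesgue" by auto
  have \<phi>int: "integrable (lebesgue_on I) \<phi>" and \<phi>fr: "AE s in lebesgue_on I. \<phi> s \<in> frontier \<Omega>0"
    and \<phi>avg: "\<And>J. proper_interval J \<Longrightarrow> J \<subseteq> I \<Longrightarrow> average \<phi> J \<notin> \<Omega>1"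
    using \<open>\<phi> \<in> class_A \<Omega>0 \<Omega>1 I\<close> by (auto simp: class_A_def)
  \<comment> \<open>Containing no line, \<open>\<Omega>0\<close> is not the whole plane, so its
    frontier is nonempty and supplies a default value \<open>p0\<close>.\<close>
  have "\<Omega>0 \<noteq> UNIV"
    using \<open>\<not> contains_line \<Omega>0\<close> zero_neq_one[where ?'a = "real ^ 2"]
    by (auto simp: contains_line_def)
  then obtain p0 where p0: "p0 \<in> frontier \<Omega>0"
    using \<open>\<Omega>0 \<noteq> {}\<close> frontier_eq_empty[of \<Omega>0] by blast
  have "AE t in lebesgue. t \<in> I \<longrightarrow> \<phi> t \<in> frontier \<Omega>0"
    using \<phi>fr Is by (subst (asm) AE_restrict_space_iff) auto
  then obtain N0 where N0: "N0 \<in> null_sets lebesgue" "{t. \<not> (t \<in> I \<longrightarrow> \<phi> t \<in> frontier \<Omega>0)} \<subseteq> N0"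
    by (auto simp: eventually_ae_filter)
  \<comment> \<open>\<open>N\<close> also contains the endpoints \<open>u\<close> and
    \<open>v\<close>, which may or may not belong to \<open>I\<close>.\<close>
  define N where "N = N0 \<union> {u, v}"
  have N: "negligible N"
    using N0(1) by (auto simp: N_def negligible_iff_null_sets[symmetric])
  have N_AE: "AE t in lebesgue. t \<notin> N"
    using N by (intro AE_not_in) (simp add: negligible_iff_null_sets)
  \<comment> \<open>The default \<open>p0\<close> outside \<open>I\<close> and at exceptional points
    gives frontier values everywhere, while \<open>\<psi>\<close> still equals \<open>\<phi>\<close>
    on \<open>{u..v}\<close> off the null set \<open>N\<close>.\<close>
  define \<psi> where "\<psi> t = (if t \<in> I \<and> \<phi> t \<in> frontier \<Omega>0 then \<phi> t else p0)" for t
  have \<psi>_eq: "\<psi> t = \<phi> t" "t \<in> I" if "t \<in> {u..v} - N" for t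
    using that N0(2) uv(2) by (auto simp: \<psi>_def N_def subset_eq)
  have \<psi>_fr: "\<psi> t \<in> frontier \<Omega>0" for t
    using p0 by (simp add: \<psi>_def)
  have \<phi>abs: "\<phi> absolutely_integrable_on I"
    using \<phi>int Is integrable_restrict_space[of I lebesgue \<phi>] unfolding set_integrable_def by simp
  have "{x \<in> I - {u..v}. \<phi> x \<noteq> 0} \<subseteq> {u, v}"
    using uv(3) by auto
  moreover have "x \<in> {u, v}" if "x \<in> {u..v}" "x \<notin> I" for x
    using that uv(2) less_eq_real_def[of u x] less_eq_real_def[of x v] by auto
  then have "{x \<in> {u..v} - I. \<phi> x \<noteq> 0} \<subseteq> {u, v}" by blast
  ultimately have "negligible {x \<in> I - {u..v}. \<phi> x \<noteq> 0}" "negligible {x \<in> {u..v} - I. \<phi> x \<noteq> 0}"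
    using negligible_subset[of "{u, v}"] by simp_all
  then have "\<phi> absolutely_integrable_on {u..v}"
    using \<phi>abs absolutely_integrable_spike_set_eq by blast
  then have \<psi>abs: "\<psi> absolutely_integrable_on {u..v}"
    by (rule absolutely_integrable_spike[OF _ N]) (rule \<psi>_eq)
  have rescale: "((\<lambda>s. h (u + c * s)) has_integral (1 / c) *\<^sub>R integral {u + c * x..u + c * y} h) {x..y}"
    if h: "h integrable_on {u..v}" and xy: "0 \<le> x" "y \<le> 1"
    for h :: "real \<Rightarrow> 'b::euclidean_space" and x y
  proof (rule has_integral_rescale[OF integrable_integral c])
    have "c * y \<le> c * 1" "0 \<le> c * x" using c xy by (auto intro: mult_left_mono)
    then show "h integrable_on {u + c * x..u + c * y}"
      by (intro integrable_subinterval_real[OF h]) (auto simp: c_def)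
  qed
  define f where "f s = \<psi> (u + c * s)" for s
  have f: "integrable std_space f"
  proof -
    have "f integrable_on {0..1}" "(\<lambda>s. norm (f s)) integrable_on {0..1}"
      using rescale[of \<psi> 0 1] rescale[of "\<lambda>t. norm (\<psi> t)" 0 1] \<psi>abs
      by (auto simp: f_def[abs_def] absolutely_integrable_on_def integrable_on_def)
    then show ?thesis
      unfolding std_space_def
      by (intro absolutely_integrable_imp_integrable) (auto simp: absolutely_integrable_on_def)
  qed
  have f_fr: "f s \<in> frontier \<Omega>0" for s
    using \<psi>_fr by (simp add: f_def)
  have avoid: "(1 / (y - x)) *\<^sub>R integral {x..y} f \<notin> closure W" if xy: "0 \<le> x" "x < y" "y \<le> 1" for x y
  proof -
    define x' y' where "x' = u + c * x" and "y' = u + c * y"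
    have "c * y \<le> c * 1" "0 \<le> c * x" "c * x < c * y" using c xy by (auto intro: mult_left_mono)
    then have xy': "u \<le> x'" "x' < y'" "y' \<le> v" by (auto simp: x'_def y'_def c_def)
    \<comment> \<open>The open interval is taken because \<open>I\<close> may lack its endpoints;
      the average is the same.\<close>
    have sub: "{x'<..<y'} \<subseteq> I" using xy' uv(2) by auto
    have "\<phi> absolutely_integrable_on {x'<..<y'}"
      using sub by (intro set_integrable_subset[OF \<phi>abs]) auto
    then have "integrable (lebesgue_on {x'<..<y'}) \<phi>"
      by (intro absolutely_integrable_imp_integrable) auto
    then have "integral\<^sup>L (lebesgue_on {x'<..<y'}) \<phi> = integral {x'<..<y'} \<phi>"
      by (intro lebesgue_integral_eq_integral) auto
    also have "\<dots> = integral {x'..y'} \<phi>"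
      using integral_open_interval[of x' y' \<phi>] by simp
    also have "\<dots> = integral {x'..y'} \<psi>"
      using xy' by (intro integral_spike[OF N] \<psi>_eq) auto
    finally have 1: "average \<phi> {x'<..<y'} = (1 / (y' - x')) *\<^sub>R integral {x'..y'} \<psi>"
      using xy' by (simp add: average_def)
    have "integral {x..y} f = (1 / c) *\<^sub>R integral {x'..y'} \<psi>"
      unfolding f_def[abs_def] x'_def y'_def
      using \<psi>abs xy by (intro integral_unique rescale) (auto simp: absolutely_integrable_on_def)
    moreover have "y' - x' = c * (y - x)" by (simp add: x'_def y'_def algebra_simps)
    ultimately have "(1 / (y - x)) *\<^sub>R integral {x..y} f = average \<phi> {x'<..<y'}"
      by (simp add: 1 mult.commute)
    moreover have "proper_interval {x'<..<y'}"
      using xy'(2) by (simp add: proper_interval_def)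
    ultimately show ?thesis using \<phi>avg sub W(4) by auto
  qed
  obtain S M where SM: "w_martingale std_space (closure \<Omega>0 - W) S M"
    "terminal_value std_space (closure \<Omega>0 - W) S M f"
    by (rule unit_interval_martingale[OF \<open>open \<Omega>0\<close> \<open>convex \<Omega>0\<close> \<open>\<not> contains_segment (frontier \<Omega>0)\<close>
        W(3,2) \<open>W \<subseteq> \<Omega>0\<close> f f_fr avoid])
  have "equimeasurable std_space f I \<phi>"
    unfolding equimeasurable_def
  proof (rule measure_eqI)
    fix A assume "A \<in> sets (distr std_space borel f)"
    then have A: "A \<in> sets borel" by simp
    have fm: "f \<in> borel_measurable std_space" using f by simp
    have \<phi>m: "\<phi> \<in> borel_measurable (lebesgue_on I)" using \<phi>int by simp
    have \<psi>m: "\<psi> \<in> borel_measurable (lebesgue_on {u..v})"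
      using absolutely_integrable_imp_integrable[OF \<psi>abs] by simp
    \<comment> \<open>Three preimages of \<open>A\<close> are compared: \<open>C\<close> is the
      image of \<open>B\<close> under an affine map scaling lengths by \<open>c\<close>, and
      \<open>D\<close> agrees with \<open>C\<close> up to a null set. The normalizing factor
      \<open>1 / c\<close> cancels the scaling.\<close>
    define B where "B = f -` A \<inter> {0..1}"
    define C where "C = \<psi> -` A \<inter> {u..v}"
    define D where "D = \<phi> -` A \<inter> I"
    have Bs: "B \<in> sets lebesgue"
      using measurable_sets[OF fm A] by (simp add: B_def std_space_def sets_restrict_space_iff)
    have Cs: "C \<in> sets lebesgue"
      using measurable_sets[OF \<psi>m A] by (simp add: C_def sets_restrict_space_iff)
    have Ds: "D \<in> sets lebesgue"
      using measurable_sets[OF \<phi>m A] Is by (simp add: D_def sets_restrict_space_iff)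
    have "(\<lambda>s. c *\<^sub>R s + u) ` B = C"
    proof
      show "(\<lambda>s. c *\<^sub>R s + u) ` B \<subseteq> C"
      proof
        fix t assume "t \<in> (\<lambda>s. c *\<^sub>R s + u) ` B"
        then obtain s where s: "s \<in> B" "t = u + c * s" by auto
        then have "0 \<le> c * s" "c * s \<le> c * 1"
          using c by (auto simp: B_def intro!: mult_nonneg_nonneg mult_left_mono)
        then have "t \<in> {u..v}" by (auto simp: s(2) c_def)
        then show "t \<in> C" using s by (simp add: B_def C_def f_def)
      qed
      show "C \<subseteq> (\<lambda>s. c *\<^sub>R s + u) ` B"
      proof
        fix t assume t: "t \<in> C"
        then have "(t - u) / c \<in> B" using c by (auto simp: B_def C_def f_def c_def)
        moreover have "t = c *\<^sub>R ((t - u) / c) + u" using c by simp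
        ultimately show "t \<in> (\<lambda>s. c *\<^sub>R s + u) ` B" by blast
      qed
    qed
    then have "emeasure lebesgue C = ennreal c * emeasure lebesgue B"
      using emeasure_lebesgue_affine[of c u B] c by simp
    also have "emeasure lebesgue C = emeasure lebesgue D"
    proof (rule emeasure_eq_AE[OF _ Cs Ds])
      show "AE t in lebesgue. t \<in> C \<longleftrightarrow> t \<in> D"
        using N_AE
      proof eventually_elim
        case (elim t)
        then show ?case using \<psi>_eq[of t] uv(3) by (auto simp: C_def D_def)
      qed
    qed
    finally have DB: "emeasure lebesgue D = ennreal c * emeasure lebesgue B" .
    have "emeasure lebesgue I = emeasure lebesgue {u..v}"
    proof (rule emeasure_eq_AE[OF _ Is])
      show "AE t in lebesgue. t \<in> I \<longleftrightarrow> t \<in> {u..v}"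
        using N_AE
      proof eventually_elim
        case (elim t)
        then show ?case using \<psi>_eq[of t] uv(3) by auto
      qed
    qed simp
    then have mI: "measure lebesgue I = c"
      using uv(1) by (simp add: measure_def c_def)
    have "emeasure (distr std_space borel f) A = emeasure lebesgue B"
      using fm A Bs by (simp add: emeasure_distr std_space_def B_def emeasure_restrict_space)
    also have "\<dots> = ennreal (1 / c) * (ennreal c * emeasure lebesgue B)"
      using c by (simp add: mult.assoc[symmetric] ennreal_mult[symmetric])
    also have "\<dots> = ennreal (1 / c) * emeasure (lebesgue_on I) D"
    proof -
      have "emeasure (lebesgue_on I) D = emeasure lebesgue D"
        using Is by (intro emeasure_restrict_space) (auto simp: D_def)
      then show ?thesis by (simp add: DB)
    qed
    also have "\<dots> = emeasure (normalized_lebesgue I) D"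
      by (simp add: normalized_lebesgue_def mI)
    also have "\<dots> = emeasure (distr (normalized_lebesgue I) borel \<phi>) A"
      using \<phi>m A by (subst emeasure_distr)
        (auto simp: normalized_lebesgue_def D_def space_scale_measure cong: measurable_cong_sets)
    finally show "emeasure (distr std_space borel f) A = emeasure (distr (normalized_lebesgue I) borel \<phi>) A" .
  qed simp
  then show ?thesis using SM unfolding W(1) by blast
qed

end
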